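(* Let $\Gamma$ be a finitely generated group with a normal nilpotent subgroup $N$, let $\pi:\Gamma\to\Lambda=\Gamma/N$ be the quotient map, and suppose there is a descending sequence of subgroups, each normal in $\Gamma$, $$N=N_1\vartriangleright N_2\vartriangleright\cdots\vartriangleright N_k\vartriangleright N_{k+1}=\operatorname{Tor}(N),$$ such that for $1\le h\le k$, $[N,N_h]\subseteq N_{h+1}$ and $N_h/N_{h+1}$ is free abelian. Let $\bar\rho_h:\Lambda\to\operatorname{Aut}(N_h/N_{h+1})$ be the homomorphism induced by conjugation. Let $S=B\cup S_0$ be a finite symmetric generating set of $\Gamma$ with $B\cap S_0=\emptyset$, such that $B$ generates $N$ and $\bar S_0=\pi(S_0)$ generates $\Lambda$. Assume: (1) $\Lambda$ is virtually nilpotent, and $\bar S_0$ is a graded symmetric generating set of $\Lambda$. (2) For every $\gamma\in S_0$, if $\pi(\gamma)$ has infinite order, then all eigenvalues of $\bar\rho_h(\pi(\gamma))$ have norm one, for $1\le h\le k$. Then $\Gamma$ has at most polynomial growth.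
   Context: $\operatorname{Tor}(N)$ is the torsion subgroup of the nilpotent group $N$. $\bar\rho_h(\pi(\gamma))(\alpha N_{h+1})=\gamma\alpha\gamma^{-1}N_{h+1}$; this is well defined on $\Lambda$ because $[N,N_h]\subseteq N_{h+1}$. Since $N_h/N_{h+1}\cong\mathbb Z^{m_h}$, $\bar\rho_h(\pi(\gamma))$ is an integer matrix and its eigenvalues are its complex eigenvalues. A generating set is symmetric if it is closed under inverses. A group is virtually nilpotent if it has a nilpotent subgroup of finite index. For a finitely generated nilpotent group $H=H_0\vartriangleright H_1\vartriangleright\cdots\vartriangleright H_s=e$, $H_{i+1}=[H,H_i]$, a graded symmetric generating set is one obtained by starting with finitely many generators of $H_{s-1}$, extending them to a generating set of $H_{s-2}$ by adding elements of $H_{s-2}-H_{s-1}$, continuing up to $H_0=H$, and then adjoining all inverses. For a virtually nilpotent group $\Lambda$, a graded symmetric generating set consists of a graded generating set $\{\tau_1,\dots,\tau_m\}$ of a nilpotent subgroup $H$ of finite index together with coset representatives $\beta_1,\dots,\beta_c$ of $H$ in $\Lambda$ (and inverses). For a finite symmetric generating set $S$, $|\gamma|_S$ denotes word length and $\Gamma(R,S)=\{\gamma:|\gamma|_S\le R\}$. $\Gamma$ has at most polynomial growth if $|\Gamma(R,S)|\le R^m$ for all large $R$ and some constant $m$ (independent of $S$). *)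

theory Defs
  imports
    "HOL-Algebra.Algebra"
    "Jordan_Normal_Form.Char_Poly"
begin

section \<open>Nilpotency and torsion\<close>

definition commutator_subgroup :: "('a, 'b) monoid_scheme \<Rightarrow> 'a set \<Rightarrow> 'a set \<Rightarrow> 'a set" where
  "commutator_subgroup G H K =
     generate G (\<Union>h\<in>H. \<Union>k\<in>K. {h \<otimes>\<^bsub>G\<^esub> k \<otimes>\<^bsub>G\<^esub> inv\<^bsub>G\<^esub> h \<otimes>\<^bsub>G\<^esub> inv\<^bsub>G\<^esub> k})"

primrec lower_central :: "('a, 'b) monoid_scheme \<Rightarrow> 'a set \<Rightarrow> nat \<Rightarrow> 'a set" where
  "lower_central G H 0 = H"
| "lower_central G H (Suc i) = commutator_subgroup G H (lower_central G H i)"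

definition nilpotent_subgroup :: "('a, 'b) monoid_scheme \<Rightarrow> 'a set \<Rightarrow> bool" where
  "nilpotent_subgroup G H \<longleftrightarrow>
     subgroup H G \<and> (\<exists>s. lower_central G H s = {\<one>\<^bsub>G\<^esub>})"

definition finite_index :: "('a, 'b) monoid_scheme \<Rightarrow> 'a set \<Rightarrow> bool" where
  "finite_index G H \<longleftrightarrow> finite (rcosets\<^bsub>G\<^esub> H)"

definition virtually_nilpotent :: "('a, 'b) monoid_scheme \<Rightarrow> bool" where
  "virtually_nilpotent G \<longleftrightarrow> (\<exists>H. nilpotent_subgroup G H \<and> finite_index G H)"

definition torsion_elements :: "('a, 'b) monoid_scheme \<Rightarrow> 'a set \<Rightarrow> 'a set" where
  "torsion_elements G H = {x \<in> H. \<exists>n::nat. 0 < n \<and> x [^]\<^bsub>G\<^esub> n = \<one>\<^bsub>G\<^esub>}"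


section \<open>Generating sets, word length and growth\<close>

definition finitely_generated :: "('a, 'b) monoid_scheme \<Rightarrow> bool" where
  "finitely_generated G \<longleftrightarrow>
     (\<exists>S. finite S \<and> S \<subseteq> carrier G \<and> generate G S = carrier G)"

definition symmetric_generating_set :: "('a, 'b) monoid_scheme \<Rightarrow> 'a set \<Rightarrow> bool" where
  "symmetric_generating_set G S \<longleftrightarrow>
     S \<subseteq> carrier G \<and> (\<forall>s\<in>S. inv\<^bsub>G\<^esub> s \<in> S) \<and> generate G S = carrier G"

text \<open>Because word length is used for symmetric generating sets only, inverses of letters need
  not be allowed separately, and every group element is the value of some word.\<close>

definition word_length :: "('a, 'b) monoid_scheme \<Rightarrow> 'a set \<Rightarrow> 'a \<Rightarrow> nat" where
  "word_length G S g =
     (LEAST n. \<exists>ws. set ws \<subseteq> S \<and> length ws = n \<and> foldr (\<otimes>\<^bsub>G\<^esub>) ws \<one>\<^bsub>G\<^esub> = g)"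

definition word_ball :: "('a, 'b) monoid_scheme \<Rightarrow> nat \<Rightarrow> 'a set \<Rightarrow> 'a set" where
  "word_ball G R S = {g \<in> carrier G. word_length G S g \<le> R}"

text \<open>The exponent is chosen before the generating set.  The notion is meant for finitely
  generated groups; otherwise it holds vacuously.\<close>

definition polynomial_growth :: "('a, 'b) monoid_scheme \<Rightarrow> bool" where
  "polynomial_growth G \<longleftrightarrow>
     (\<exists>m. \<forall>S. finite S \<and> symmetric_generating_set G S \<longrightarrow>
        (\<exists>R\<^sub>0. \<forall>R\<ge>R\<^sub>0. card (word_ball G R S) \<le> R ^ m))"


section \<open>Graded symmetric generating sets\<close>

text \<open>With \<open>H\<^sub>i\<close> the lower central series of \<open>H\<close>, the predicate \<open>graded_gens G H i T\<close> says that
  \<open>T\<close> is what the construction has produced on reaching \<open>H\<^sub>i\<close>.  Starting at any \<open>i\<close>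
  with \<open>H\<^sub>i\<^sub>+\<^sub>1\<close> trivial (rather than at the last nontrivial term) yields the same
  sets, and also covers trivial \<open>H\<close>.\<close>

inductive graded_gens :: "('a, 'b) monoid_scheme \<Rightarrow> 'a set \<Rightarrow> nat \<Rightarrow> 'a set \<Rightarrow> bool"
  for G and H where
  start: "\<lbrakk>lower_central G H (Suc i) = {\<one>\<^bsub>G\<^esub>}; finite T; T \<subseteq> lower_central G H i;
           generate G T = lower_central G H i\<rbrakk> \<Longrightarrow> graded_gens G H i T"
| extend: "\<lbrakk>graded_gens G H (Suc i) T; finite A;
            A \<subseteq> lower_central G H i - lower_central G H (Suc i);
            generate G (T \<union> A) = lower_central G H i\<rbrakk> \<Longrightarrow> graded_gens G H i (T \<union> A)"

definition graded_generating_set :: "('a, 'b) monoid_scheme \<Rightarrow> 'a set \<Rightarrow> 'a set \<Rightarrow> bool" where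
  "graded_generating_set G H T \<longleftrightarrow> graded_gens G H 0 T"

text \<open>As inverses are adjoined below, it is immaterial whether representatives of left or of
  right cosets are used: inversion exchanges the two.\<close>

definition coset_representatives :: "('a, 'b) monoid_scheme \<Rightarrow> 'a set \<Rightarrow> 'a set \<Rightarrow> bool" where
  "coset_representatives G H C \<longleftrightarrow>
     C \<subseteq> carrier G \<and> bij_betw (\<lambda>x. H #>\<^bsub>G\<^esub> x) C (rcosets\<^bsub>G\<^esub> H)"

definition graded_symmetric_generating_set :: "('a, 'b) monoid_scheme \<Rightarrow> 'a set \<Rightarrow> bool" where
  "graded_symmetric_generating_set G U \<longleftrightarrow>
     (\<exists>H T C. nilpotent_subgroup G H \<and> finite_index G H \<and>
        graded_generating_set G H T \<and> coset_representatives G H C \<and>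
        U = (T \<union> C) \<union> (\<lambda>x. inv\<^bsub>G\<^esub> x) ` (T \<union> C))"


section \<open>Free abelian sections and eigenvalues\<close>

text \<open>A basis of \<open>M\<close> is a subset of its carrier, so it suffices to look for index sets in the
  type of elements of \<open>M\<close>.\<close>

definition free_abelian :: "('a, 'b) monoid_scheme \<Rightarrow> bool" where
  "free_abelian M \<longleftrightarrow> (\<exists>B::'a set. M \<cong> free_Abelian_group B)"

abbreviation section_group :: "('a, 'b) monoid_scheme \<Rightarrow> 'a set \<Rightarrow> 'a set \<Rightarrow> 'a set monoid" where
  "section_group G H K \<equiv> (G\<lparr>carrier := H\<rparr>) Mod K"

text \<open>The matrix of an endomorphism \<open>\<phi>\<close> with respect to the basis \<open>f (frag_of j)\<close>, \<open>j < m\<close>;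
  column \<open>j\<close> consists of the coordinates of the image of the \<open>j\<close>-th basis element.\<close>

definition endo_matrix ::
  "('a, 'b) monoid_scheme \<Rightarrow> nat \<Rightarrow> ((nat \<Rightarrow>\<^sub>0 int) \<Rightarrow> 'a) \<Rightarrow> ('a \<Rightarrow> 'a) \<Rightarrow> int mat" where
  "endo_matrix M m f \<phi> = mat m m (\<lambda>(i, j).
     Poly_Mapping.lookup
       (inv_into (carrier (free_Abelian_group {..<m})) f (\<phi> (f (frag_of j)))) i)"

definition endo_eigenvalue :: "('a, 'b) monoid_scheme \<Rightarrow> ('a \<Rightarrow> 'a) \<Rightarrow> complex \<Rightarrow> bool" where
  "endo_eigenvalue M \<phi> c \<longleftrightarrow>
     (\<exists>m f. f \<in> iso (free_Abelian_group {..<m}) M \<and>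
        eigenvalue (map_mat complex_of_int (endo_matrix M m f \<phi>)) c)"

text \<open>The action of \<open>G Mod N\<close> on \<open>H / K\<close> by conjugation.  For \<open>Q = N\<gamma>\<close> and \<open>C = K\<alpha>\<close> all the
  cosets in the union coincide; see the lemmas below.\<close>

definition conj_action ::
  "('a, 'b) monoid_scheme \<Rightarrow> 'a set \<Rightarrow> 'a set \<Rightarrow> 'a set \<Rightarrow> 'a set \<Rightarrow> 'a set" where
  "conj_action G H K Q = (\<lambda>C \<in> carrier (section_group G H K).
     \<Union>\<gamma>\<in>Q. \<Union>\<alpha>\<in>C. K #>\<^bsub>G\<^esub> (\<gamma> \<otimes>\<^bsub>G\<^esub> \<alpha> \<otimes>\<^bsub>G\<^esub> inv\<^bsub>G\<^esub> \<gamma>))"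

context
  fixes G :: "('a, 'b) monoid_scheme" (structure) and N H K :: "'a set"
  assumes G: "group G" and N: "N \<lhd> G" and H: "H \<lhd> G" and K: "K \<lhd> G"
    and KH: "K \<subseteq> H" and comm: "commutator_subgroup G N H \<subseteq> K"
begin

lemma carrier_section_group: "carrier (section_group G H K) = (\<lambda>\<alpha>. K #> \<alpha>) ` H"
  by (auto simp: FactGroup_def RCOSETS_def r_coset_def)

lemma conj_action_coset:
  assumes g: "\<gamma> \<in> carrier G" and a: "\<alpha> \<in> H"
  shows "conj_action G H K (N #> \<gamma>) (K #> \<alpha>) = K #> (\<gamma> \<otimes> \<alpha> \<otimes> inv \<gamma>)"
proof -
  interpret group G by (rule G)
  have sN: "subgroup N G" and sH: "subgroup H G" and sK: "subgroup K G"
    using N H K by (simp_all add: normal_imp_subgroup)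
  have carr: "\<And>x. x \<in> N \<Longrightarrow> x \<in> carrier G" "\<And>x. x \<in> H \<Longrightarrow> x \<in> carrier G"
    "\<And>x. x \<in> K \<Longrightarrow> x \<in> carrier G"
    using sN sH sK subgroup.mem_carrier by metis+
  have eq: "K #> (\<gamma>' \<otimes> \<alpha>' \<otimes> inv \<gamma>') = K #> (\<gamma> \<otimes> \<alpha> \<otimes> inv \<gamma>)"
    if g': "\<gamma>' \<in> N #> \<gamma>" and a': "\<alpha>' \<in> K #> \<alpha>" for \<gamma>' \<alpha>'
  proof -
    from g' obtain n where n: "n \<in> N" "\<gamma>' = n \<otimes> \<gamma>" by (auto simp: r_coset_def)
    from a' obtain c where c: "c \<in> K" "\<alpha>' = c \<otimes> \<alpha>" by (auto simp: r_coset_def)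
    define b where "b = \<gamma> \<otimes> \<alpha> \<otimes> inv \<gamma>"
    have b: "b \<in> H" unfolding b_def using normal.inv_op_closed2[OF H g a] .
    define d where "d = n \<otimes> b \<otimes> inv n \<otimes> inv b"
    have "d \<in> commutator_subgroup G N H"
      unfolding commutator_subgroup_def d_def using n(1) b by (auto intro!: generate.incl)
    then have d: "d \<in> K" using comm by auto
    define e where "e = \<gamma>' \<otimes> c \<otimes> inv \<gamma>'"
    have gc: "\<gamma>' \<in> carrier G" using n g carr by auto
    have e: "e \<in> K" unfolding e_def using normal.inv_op_closed2[OF K gc c(1)] .
    note cs = carr(1)[OF n(1)] carr(2)[OF a] carr(2)[OF b] carr(3)[OF c(1)] carr(3)[OF d]
      carr(3)[OF e] g gc
    have "\<gamma>' \<otimes> \<alpha>' \<otimes> inv \<gamma>' = e \<otimes> (\<gamma>' \<otimes> \<alpha> \<otimes> inv \<gamma>')"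
      unfolding e_def c(2) using cs by (simp add: m_assoc inv_solve_left' flip: m_assoc[of "inv \<gamma>'" \<gamma>'])
    also have "\<gamma>' \<otimes> \<alpha> \<otimes> inv \<gamma>' = n \<otimes> b \<otimes> inv n"
      unfolding b_def n(2) using cs by (simp add: m_assoc inv_mult_group)
    also have "\<dots> = d \<otimes> b"
      unfolding d_def using cs by (simp add: m_assoc)
    also have "e \<otimes> (d \<otimes> b) = (e \<otimes> d) \<otimes> b" using cs by (simp add: m_assoc)
    finally have "K #> (\<gamma>' \<otimes> \<alpha>' \<otimes> inv \<gamma>') = K #> (e \<otimes> d) #> b"
      using cs sK by (simp add: coset_mult_assoc subgroup.subset)
    also have "K #> (e \<otimes> d) = K"
      using e d sK coset_join2 subgroup.m_closed carr(3) by metis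
    finally show ?thesis by (simp add: b_def)
  qed
  have "K #> \<alpha> \<in> carrier (section_group G H K)"
    unfolding carrier_section_group using a by auto
  moreover have "\<gamma> \<in> N #> \<gamma>" "\<alpha> \<in> K #> \<alpha>"
    using rcos_self[OF g sN] rcos_self[OF carr(2)[OF a] sK] .
  ultimately show ?thesis
    unfolding conj_action_def restrict_def by (simp only: if_True) (use eq in fast)
qed

lemma conj_action_hom:
  "conj_action G H K \<in> hom (G Mod N) (AutoGroup (section_group G H K))"
proof -
  interpret group G by (rule G)
  let ?M = "section_group G H K"
  have sN: "subgroup N G" and sH: "subgroup H G" and sK: "subgroup K G"
    using N H K by (simp_all add: normal_imp_subgroup)
  have Hc: "\<And>x. x \<in> H \<Longrightarrow> x \<in> carrier G" using sH subgroup.mem_carrier by metis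
  have conjH: "\<gamma> \<otimes> \<alpha> \<otimes> inv \<gamma> \<in> H" if "\<gamma> \<in> carrier G" "\<alpha> \<in> H" for \<gamma> \<alpha>
    using normal.inv_op_closed2[OF H that] .
  have mem: "K #> \<alpha> \<in> carrier ?M" if "\<alpha> \<in> H" for \<alpha>
    unfolding carrier_section_group using that by auto
  have multM: "(K #> \<alpha>) \<otimes>\<^bsub>?M\<^esub> (K #> \<beta>) = K #> (\<alpha> \<otimes> \<beta>)" if "\<alpha> \<in> H" "\<beta> \<in> H" for \<alpha> \<beta>
    using normal.rcos_sum[OF K Hc[OF that(1)] Hc[OF that(2)]]
    by (simp add: FactGroup_def set_mult_def)
  have cl: "conj_action G H K (N #> \<gamma>) C \<in> carrier ?M"
    if "\<gamma> \<in> carrier G" "C \<in> carrier ?M" for \<gamma> C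
    using that conj_action_coset conjH mem by (auto simp: carrier_section_group)
  have comp: "conj_action G H K (N #> \<gamma>) (conj_action G H K (N #> \<delta>) C)
      = conj_action G H K (N #> (\<gamma> \<otimes> \<delta>)) C"
    if gd: "\<gamma> \<in> carrier G" "\<delta> \<in> carrier G" and C: "C \<in> carrier ?M" for \<gamma> \<delta> C
  proof -
    obtain \<alpha> where a: "\<alpha> \<in> H" "C = K #> \<alpha>" using C by (auto simp: carrier_section_group)
    show ?thesis
      using gd a conjH Hc by (simp add: conj_action_coset m_assoc inv_mult_group)
  qed
  have one: "conj_action G H K (N #> \<one>) C = C" if "C \<in> carrier ?M" for C
    using that Hc by (auto simp: carrier_section_group conj_action_coset)
  have ext: "conj_action G H K Q \<in> extensional (carrier ?M)" for Q
    unfolding conj_action_def by (rule restrict_extensional)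
  have auto: "conj_action G H K (N #> \<gamma>) \<in> auto ?M" if g: "\<gamma> \<in> carrier G" for \<gamma>
  proof -
    have "conj_action G H K (N #> \<gamma>) \<in> hom ?M ?M"
    proof (rule homI)
      fix C D assume "C \<in> carrier ?M" "D \<in> carrier ?M"
      then obtain \<alpha> \<beta> where ab: "\<alpha> \<in> H" "\<beta> \<in> H" "C = K #> \<alpha>" "D = K #> \<beta>"
        by (auto simp: carrier_section_group)
      have "\<gamma> \<otimes> (\<alpha> \<otimes> \<beta>) \<otimes> inv \<gamma> = (\<gamma> \<otimes> \<alpha> \<otimes> inv \<gamma>) \<otimes> (\<gamma> \<otimes> \<beta> \<otimes> inv \<gamma>)"
        using g Hc[OF ab(1)] Hc[OF ab(2)]
        by (simp add: m_assoc flip: m_assoc[of "inv \<gamma>" \<gamma>])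
      then show "conj_action G H K (N #> \<gamma>) (C \<otimes>\<^bsub>?M\<^esub> D)
          = conj_action G H K (N #> \<gamma>) C \<otimes>\<^bsub>?M\<^esub> conj_action G H K (N #> \<gamma>) D"
        unfolding ab(3,4) multM[OF ab(1,2)]
        using conj_action_coset[OF g] ab conjH[OF g] subgroup.m_closed[OF sH] multM by metis
    qed (rule cl[OF g])
    moreover have "bij_betw (conj_action G H K (N #> \<gamma>)) (carrier ?M) (carrier ?M)"
      by (rule bij_betw_byWitness[where f' = "conj_action G H K (N #> inv \<gamma>)"])
        (use g comp one cl in auto)
    ultimately show ?thesis using ext by (simp add: auto_def Bij_def)
  qed
  show ?thesis
  proof (rule homI)
    fix P Q assume "P \<in> carrier (G Mod N)" "Q \<in> carrier (G Mod N)"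
    then obtain \<gamma> \<delta> where gd: "\<gamma> \<in> carrier G" "\<delta> \<in> carrier G" "P = N #> \<gamma>" "Q = N #> \<delta>"
      by (auto simp: carrier_FactGroup)
    have B: "conj_action G H K P \<in> Bij (carrier ?M)" "conj_action G H K Q \<in> Bij (carrier ?M)"
      using auto gd by (auto simp: auto_def)
    have PQ: "P \<otimes>\<^bsub>G Mod N\<^esub> Q = N #> (\<gamma> \<otimes> \<delta>)"
      using gd normal.rcos_sum[OF N] by simp
    have "conj_action G H K (N #> (\<gamma> \<otimes> \<delta>))
        = compose (carrier ?M) (conj_action G H K P) (conj_action G H K Q)"
      by (rule extensionalityI[OF ext compose_extensional]) (simp add: compose_eq gd comp)
    then show "conj_action G H K (P \<otimes>\<^bsub>G Mod N\<^esub> Q)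
        = conj_action G H K P \<otimes>\<^bsub>AutoGroup ?M\<^esub> conj_action G H K Q"
      using B PQ by (simp add: AutoGroup_def BijGroup_def)
  next
    fix P assume "P \<in> carrier (G Mod N)"
    then show "conj_action G H K P \<in> carrier (AutoGroup ?M)"
      using auto by (auto simp: carrier_FactGroup AutoGroup_def)
  qed
qed

end

end

theory Submission
  imports Defs "Jordan_Normal_Form.Schur_Decomposition"
begin

text \<open>Adjoin generators one at a time. If \<open>t\<close> normalises a subgroup \<open>K\<close> of polynomial growth and
  every \<open>t\<^sup>a x t\<^sup>-\<^sup>a\<close> with \<open>x \<in> K\<close> is a product of polynomially many (in \<open>a\<close>) elements of a fixed
  finite subset of \<open>K\<close>, then moving all powers of \<open>t\<close> to the right shows that \<open>K\<close> and \<open>t\<close> generate a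
  group of polynomial growth. That condition passes from the commutator \<open>[t, x]\<close> to \<open>x\<close> and from a
  power \<open>t\<^sup>e\<close> to \<open>t\<close>, so it suffices that iterated commutation with suitable powers of \<open>t\<close> leads
  every \<open>x \<in> K\<close> into the finite group \<open>Tor(N)\<close>. Take for \<open>t\<close> lifts of graded generators of the
  nilpotent group \<open>H\<close> of finite index, starting from the bottom of its lower central series:
  commutation with \<open>t\<close> leads into \<open>N\<close> by nilpotency of \<open>H\<close>, and from \<open>N\<^sub>h\<close> into \<open>N\<^sub>h\<^sub>+\<^sub>1\<close> since,
  by Kronecker's theorem, an integer matrix all of whose eigenvalues have norm one has a unipotent
  power.\<close>

section \<open>Polynomial growth\<close>

text \<open>The eigenvalue hypothesis speaks only of letters in \<open>S\<^sub>0\<close>. Hence the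
  graded set: it contains generators of every term of the lower central series of \<open>H\<close>,
  whereas commutators of generators of \<open>H\<close> are not directly covered by the hypothesis.
  The order from the bottom upwards comes from normality: a subgroup between two consecutive terms
  is normalised, because commutators fall into the lower term. Letters whose image in the quotient
  has finite order need a separate reason: a power of such a letter lies in \<open>N\<close>, and
  \<open>[N, Ns h]\<close> is contained in \<open>Ns (h + 1)\<close>. Only \<open>N\<close> is given
  with a finite generating set. That the sections have finite rank, so that matrices exist, and that
  the torsion subgroup is finite is obtained from polycyclic groups: a finitely generated nilpotent
  group is polycyclic, this passes to all subgroups, polycyclic groups are finitely generated, and
  those that are torsion are finite. The growth of \<open>N\<close> itself is the same adjoining
  argument, run along its own lower central series.\<close>

definition word_products :: "('a, 'b) monoid_scheme \<Rightarrow> 'a set \<Rightarrow> nat \<Rightarrow> 'a set" where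
  "word_products G F n = {foldr (\<otimes>\<^bsub>G\<^esub>) ws \<one>\<^bsub>G\<^esub> | ws. set ws \<subseteq> F \<and> length ws \<le> n}"

definition conj_by :: "('a, 'b) monoid_scheme \<Rightarrow> 'a \<Rightarrow> 'a \<Rightarrow> 'a" where
  "conj_by G g x = g \<otimes>\<^bsub>G\<^esub> x \<otimes>\<^bsub>G\<^esub> inv\<^bsub>G\<^esub> g"

definition commutator :: "('a, 'b) monoid_scheme \<Rightarrow> 'a \<Rightarrow> 'a \<Rightarrow> 'a" where
  "commutator G g x = g \<otimes>\<^bsub>G\<^esub> x \<otimes>\<^bsub>G\<^esub> inv\<^bsub>G\<^esub> g \<otimes>\<^bsub>G\<^esub> inv\<^bsub>G\<^esub> x"

text \<open>Closure under \<open>t\<close> and under its inverse makes conjugation by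
  \<open>t\<close> a bijection of \<open>K\<close>. With \<open>t\<close> alone the image could be a
  proper subset, and conjugation by negative powers could leave \<open>K\<close>.\<close>

definition normalises :: "('a, 'b) monoid_scheme \<Rightarrow> 'a \<Rightarrow> 'a set \<Rightarrow> bool" where
  "normalises G t K \<longleftrightarrow> (\<forall>x\<in>K. conj_by G t x \<in> K \<and> conj_by G (inv\<^bsub>G\<^esub> t) x \<in> K)"

text \<open>\<open>Suc n\<close> keeps the bound meaningful at \<open>0\<close>, so it can be
  demanded for all \<open>n\<close> and sums, products and composites are handled without
  thresholds.\<close>

definition poly_bounded :: "(nat \<Rightarrow> nat) \<Rightarrow> bool" where
  "poly_bounded f \<longleftrightarrow> (\<exists>C d. \<forall>n. f n \<le> C * Suc n ^ d)"

text \<open>Quantifying over all finite subsets lets the letters change along the way: moving powers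
  of \<open>t\<close> through a word creates new letters in \<open>K\<close>.\<close>

definition poly_growth_on :: "('a, 'b) monoid_scheme \<Rightarrow> 'a set \<Rightarrow> bool" where
  "poly_growth_on G K \<longleftrightarrow>
     (\<forall>F. finite F \<and> F \<subseteq> K \<longrightarrow> poly_bounded (\<lambda>n. card (word_products G F n)))"

text \<open>The letters have to lie in \<open>K\<close>, because the growth of \<open>K\<close> is
  applied to words in them. They and the constants may depend on \<open>x\<close>, but not on the
  exponent \<open>a\<close>, which takes both signs.\<close>

definition poly_conjugated :: "('a, 'b) monoid_scheme \<Rightarrow> 'a set \<Rightarrow> 'a \<Rightarrow> 'a \<Rightarrow> bool" where
  "poly_conjugated G K t x \<longleftrightarrow> (\<exists>F C d. finite F \<and> F \<subseteq> K \<and>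
     (\<forall>a::int. conj_by G (t [^]\<^bsub>G\<^esub> a) x \<in> word_products G F (C * Suc (nat \<bar>a\<bar>) ^ d)))"

section \<open>Polynomially bounded functions\<close>

lemma poly_boundedI: "(\<And>n. f n \<le> C * Suc n ^ d) \<Longrightarrow> poly_bounded f"
  unfolding poly_bounded_def by blast

lemma poly_bounded_mono: "poly_bounded g \<Longrightarrow> (\<And>n. f n \<le> g n) \<Longrightarrow> poly_bounded f"
  unfolding poly_bounded_def by (meson order_trans)

lemma poly_bounded_const: "poly_bounded (\<lambda>n. c)"
  by (rule poly_boundedI[of _ c 0]) simp

lemma poly_bounded_id: "poly_bounded (\<lambda>n. n)"
  by (rule poly_boundedI[of _ 1 1]) simp

lemma poly_bounded_mult:
  assumes "poly_bounded f" "poly_bounded g"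
  shows "poly_bounded (\<lambda>n. f n * g n)"
proof -
  obtain C d C' d' where "\<And>n. f n \<le> C * Suc n ^ d" "\<And>n. g n \<le> C' * Suc n ^ d'"
    using assms unfolding poly_bounded_def by auto
  then have "f n * g n \<le> (C * Suc n ^ d) * (C' * Suc n ^ d')" for n
    by (intro mult_le_mono)
  then have "f n * g n \<le> (C * C') * Suc n ^ (d + d')" for n
    by (simp add: power_add algebra_simps)
  then show ?thesis by (rule poly_boundedI)
qed

lemma poly_bounded_add:
  assumes "poly_bounded f" "poly_bounded g"
  shows "poly_bounded (\<lambda>n. f n + g n)"
proof -
  obtain C d C' d' where *: "\<And>n. f n \<le> C * Suc n ^ d" "\<And>n. g n \<le> C' * Suc n ^ d'"
    using assms unfolding poly_bounded_def by auto
  have "f n + g n \<le> (C + C') * Suc n ^ (d + d')" for n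
  proof -
    have "Suc n ^ d \<le> Suc n ^ (d + d')" "Suc n ^ d' \<le> Suc n ^ (d + d')"
      by (rule power_increasing; simp)+
    then have "C * Suc n ^ d \<le> C * Suc n ^ (d + d')" "C' * Suc n ^ d' \<le> C' * Suc n ^ (d + d')"
      by (auto intro: mult_le_mono2)
    then show ?thesis using *[of n] unfolding add_mult_distrib by linarith
  qed
  then show ?thesis by (rule poly_boundedI)
qed

lemma poly_bounded_Suc: "poly_bounded f \<Longrightarrow> poly_bounded (\<lambda>n. Suc (f n))"
  using poly_bounded_add[OF poly_bounded_const[of 1], of f] by simp

lemma poly_bounded_power: "poly_bounded f \<Longrightarrow> poly_bounded (\<lambda>n. f n ^ d)"
  by (induction d) (auto intro: poly_bounded_const poly_bounded_mult)

lemma poly_bounded_compose: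
  assumes "poly_bounded f" "poly_bounded g"
  shows "poly_bounded (\<lambda>n. f (g n))"
proof -
  obtain C d where "\<And>n. f n \<le> C * Suc n ^ d" using assms unfolding poly_bounded_def by auto
  then show ?thesis
    by (rule poly_bounded_mono[where g = "\<lambda>n. C * Suc (g n) ^ d", rotated])
      (auto intro: assms(2) intro!: poly_bounded_mult poly_bounded_power poly_bounded_const poly_bounded_Suc)
qed

lemmas poly_bounded_intros = poly_bounded_const poly_bounded_id poly_bounded_mult
  poly_bounded_add poly_bounded_Suc poly_bounded_power

context group
begin

section \<open>Conjugation and commutators\<close>

lemma conj_by_closed [simp, intro]: "g \<in> carrier G \<Longrightarrow> x \<in> carrier G \<Longrightarrow> conj_by G g x \<in> carrier G"
  by (simp add: conj_by_def)

lemma conj_by_mult: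
  "\<lbrakk>g \<in> carrier G; x \<in> carrier G; y \<in> carrier G\<rbrakk>
    \<Longrightarrow> conj_by G g (x \<otimes> y) = conj_by G g x \<otimes> conj_by G g y"
  by (simp add: conj_by_def m_assoc flip: m_assoc[of "inv g" g])

lemma conj_by_conj_by:
  "\<lbrakk>g \<in> carrier G; h \<in> carrier G; x \<in> carrier G\<rbrakk>
    \<Longrightarrow> conj_by G g (conj_by G h x) = conj_by G (g \<otimes> h) x"
  by (simp add: conj_by_def m_assoc inv_mult_group)

lemma conj_by_one [simp]: "x \<in> carrier G \<Longrightarrow> conj_by G \<one> x = x"
  by (simp add: conj_by_def)

lemma conj_by_of_one [simp]: "x \<in> carrier G \<Longrightarrow> conj_by G x \<one> = \<one>"
  by (simp add: conj_by_def)

lemma commutator_closed [simp, intro]: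
  "g \<in> carrier G \<Longrightarrow> x \<in> carrier G \<Longrightarrow> commutator G g x \<in> carrier G"
  by (simp add: commutator_def)

lemma conj_by_eq_commutator:
  "\<lbrakk>g \<in> carrier G; x \<in> carrier G\<rbrakk> \<Longrightarrow> conj_by G g x = commutator G g x \<otimes> x"
  by (simp add: conj_by_def commutator_def m_assoc)

lemma mult_eq_conj_by_mult:
  "\<lbrakk>g \<in> carrier G; x \<in> carrier G\<rbrakk> \<Longrightarrow> g \<otimes> x = conj_by G g x \<otimes> g"
  by (simp add: conj_by_def m_assoc)

lemma conj_by_int_pow_closed:
  assumes "normalises G t K" "t \<in> carrier G" "K \<subseteq> carrier G" "x \<in> K"
  shows "conj_by G (t [^] (a::int)) x \<in> K"
proof -
  have "conj_by G (t [^] n) x \<in> K \<and> conj_by G (inv (t [^] n)) x \<in> K" for n :: nat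
  proof (induction n)
    case (Suc n)
    have "conj_by G (t [^] Suc n) x = conj_by G t (conj_by G (t [^] n) x)"
      using assms nat_pow_Suc2[of t n] by (subst conj_by_conj_by) (auto simp del: nat_pow_Suc)
    moreover have "conj_by G (inv (t [^] Suc n)) x = conj_by G (inv t) (conj_by G (inv (t [^] n)) x)"
      using assms by (subst conj_by_conj_by) (auto simp: inv_mult_group)
    ultimately show ?case using Suc assms unfolding normalises_def by auto
  qed (use assms in auto)
  then show ?thesis
    by (cases a rule: int_cases2) (use assms in \<open>simp_all add: int_pow_neg int_pow_int\<close>)
qed

section \<open>Words of bounded length\<close>

lemma word_products_mono: "F \<subseteq> F' \<Longrightarrow> n \<le> n' \<Longrightarrow> word_products G F n \<subseteq> word_products G F' n'"
  unfolding word_products_def by fastforce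

lemma foldr_mult_closed: "set ws \<subseteq> carrier G \<Longrightarrow> foldr (\<otimes>) ws \<one> \<in> carrier G"
  by (induction ws) auto

lemma foldr_mult_append:
  "set us \<subseteq> carrier G \<Longrightarrow> set ws \<subseteq> carrier G
    \<Longrightarrow> foldr (\<otimes>) (us @ ws) \<one> = foldr (\<otimes>) us \<one> \<otimes> foldr (\<otimes>) ws \<one>"
  by (induction us) (auto simp: m_assoc foldr_mult_closed)

lemma word_products_closed: "F \<subseteq> carrier G \<Longrightarrow> word_products G F n \<subseteq> carrier G"
  using foldr_mult_closed by (auto simp: word_products_def)

lemma word_products_subgroup:
  assumes "subgroup K G" "F \<subseteq> K" shows "word_products G F n \<subseteq> K"
proof -
  have "foldr (\<otimes>) ws \<one> \<in> K" if "set ws \<subseteq> F" for ws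
    using that by (induction ws) (use assms in \<open>auto simp: subgroup.m_closed subgroup.one_closed\<close>)
  then show ?thesis by (auto simp: word_products_def)
qed

lemma one_in_word_products: "\<one> \<in> word_products G F n"
  unfolding word_products_def by (auto intro!: exI[of _ "[]"])

lemma in_word_products: "F \<subseteq> carrier G \<Longrightarrow> x \<in> F \<Longrightarrow> 1 \<le> n \<Longrightarrow> x \<in> word_products G F n"
  unfolding word_products_def by (auto intro!: exI[of _ "[x]"])

lemma word_products_mult:
  assumes "F \<subseteq> carrier G" "x \<in> word_products G F m" "y \<in> word_products G F n"
  shows "x \<otimes> y \<in> word_products G F (m + n)"
proof -
  obtain us ws where "x = foldr (\<otimes>) us \<one>" "set us \<subseteq> F" "length us \<le> m"
    "y = foldr (\<otimes>) ws \<one>" "set ws \<subseteq> F" "length ws \<le> n"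
    using assms unfolding word_products_def by auto
  then have "x \<otimes> y = foldr (\<otimes>) (us @ ws) \<one>" "set (us @ ws) \<subseteq> F" "length (us @ ws) \<le> m + n"
    using foldr_mult_append[of us ws] assms(1) by auto
  then show ?thesis unfolding word_products_def by blast
qed

lemma finite_word_products: "finite F \<Longrightarrow> finite (word_products G F n)"
  using finite_lists_length_le[of F n] by (simp add: word_products_def setcompr_eq_image)

lemma word_products_image:
  assumes "F \<subseteq> carrier G" "x \<in> word_products G F n" "h \<one> = \<one>"
    "\<And>x y. x \<in> carrier G \<Longrightarrow> y \<in> carrier G \<Longrightarrow> h (x \<otimes> y) = h x \<otimes> h y"
  shows "h x \<in> word_products G (h ` F) n"
proof -
  obtain ws where ws: "x = foldr (\<otimes>) ws \<one>" "set ws \<subseteq> F" "length ws \<le> n"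
    using assms unfolding word_products_def by auto
  have "h (foldr (\<otimes>) ws \<one>) = foldr (\<otimes>) (map h ws) \<one>"
    using ws(2) assms(1) by (induction ws) (auto simp: assms foldr_mult_closed subset_iff)
  then show ?thesis unfolding word_products_def
    using ws by (auto intro!: exI[of _ "map h ws"]) blast
qed

lemma word_products_conj_by:
  assumes "F \<subseteq> carrier G" "x \<in> word_products G F n" "g \<in> carrier G"
  shows "conj_by G g x \<in> word_products G (conj_by G g ` F) n"
  by (rule word_products_image) (use assms in \<open>auto simp: conj_by_mult\<close>)

lemma word_products_inv:
  assumes F: "F \<subseteq> carrier G" "\<And>x. x \<in> F \<Longrightarrow> inv x \<in> F" and x: "x \<in> word_products G F n"
  shows "inv x \<in> word_products G F n"
proof -
  have "inv (foldr (\<otimes>) ws \<one>) \<in> word_products G F (length ws)" if "set ws \<subseteq> F" for ws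
    using that
  proof (induction ws)
    case (Cons w ws)
    then have "inv (foldr (\<otimes>) (w # ws) \<one>) = inv (foldr (\<otimes>) ws \<one>) \<otimes> inv w"
      using F by (auto intro!: inv_mult_group foldr_mult_closed)
    moreover have "inv w \<in> word_products G F 1"
      using Cons F by (auto intro!: in_word_products)
    ultimately show ?case
      using word_products_mult[OF F(1)] Cons by (metis Suc_eq_plus1 length_Cons list.set_intros(2) subset_code(1))
  qed (auto simp: one_in_word_products)
  moreover obtain ws where "x = foldr (\<otimes>) ws \<one>" "set ws \<subseteq> F" "length ws \<le> n"
    using x unfolding word_products_def by auto
  ultimately show ?thesis using word_products_mono[of F F "length ws" n] by auto
qed

text \<open>Substituting words for letters; this is what compares the balls of two generating
  sets.\<close>

lemma word_products_word_products:
  assumes F: "F \<subseteq> carrier G"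
  shows "word_products G (word_products G F m) n \<subseteq> word_products G F (n * m)"
proof -
  have "foldr (\<otimes>) ws \<one> \<in> word_products G F (length ws * m)" if "set ws \<subseteq> word_products G F m" for ws
    using that by (induction ws) (auto simp: one_in_word_products word_products_mult[OF F])
  then have "foldr (\<otimes>) ws \<one> \<in> word_products G F (n * m)"
    if "set ws \<subseteq> word_products G F m" "length ws \<le> n" for ws
    using that word_products_mono[of F F "length ws * m" "n * m"] by auto
  then show ?thesis unfolding word_products_def[of G "word_products G F m" n] by blast
qed

section \<open>Elements whose conjugates have polynomial length\<close>

lemma poly_conjugatedI:
  assumes "finite F" "F \<subseteq> K" "poly_bounded f"
    "\<And>a::int. conj_by G (t [^] a) x \<in> word_products G F (f (nat \<bar>a\<bar>))"
  shows "poly_conjugated G K t x"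
proof -
  obtain C d where "\<And>n. f n \<le> C * Suc n ^ d" using assms(3) unfolding poly_bounded_def by auto
  then have "conj_by G (t [^] a) x \<in> word_products G F (C * Suc (nat \<bar>a\<bar>) ^ d)" for a :: int
    using assms(4)[of a] word_products_mono[of F F] by blast
  then show ?thesis using assms unfolding poly_conjugated_def by blast
qed

text \<open>Adjoining inverses to the letters only adds words. Symmetric letters are wanted where an
  equation between conjugates is solved for one factor.\<close>

lemma poly_conjugatedE:
  assumes "poly_conjugated G K t x" "subgroup K G"
  obtains F C d where "finite F" "F \<subseteq> K" "\<And>x. x \<in> F \<Longrightarrow> inv x \<in> F"
    "\<And>a::int. conj_by G (t [^] a) x \<in> word_products G F (C * Suc (nat \<bar>a\<bar>) ^ d)"
proof -
  obtain F C d where F: "finite F" "F \<subseteq> K"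
    "\<And>a::int. conj_by G (t [^] a) x \<in> word_products G F (C * Suc (nat \<bar>a\<bar>) ^ d)"
    using assms unfolding poly_conjugated_def by blast
  let ?F = "F \<union> m_inv G ` F"
  have "F \<subseteq> carrier G" using F(2) assms(2) subgroup.subset by blast
  then have "inv x \<in> ?F" if "x \<in> ?F" for x using that by auto
  moreover have "conj_by G (t [^] a) x \<in> word_products G ?F (C * Suc (nat \<bar>a\<bar>) ^ d)" for a :: int
    using F(3)[of a] word_products_mono[of F ?F] by blast
  moreover have "finite ?F" "?F \<subseteq> K"
    using F assms(2) by (auto simp: subgroup.m_inv_closed)
  ultimately show ?thesis by (intro that[of ?F C d])
qed

text \<open>All conjugates of \<open>x\<close> stay in \<open>K\<^sub>0\<close>, so each is a single
  letter. Both the trivial group and the torsion subgroup enter the argument in this way.\<close>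

lemma poly_conjugated_finite:
  assumes "finite K\<^sub>0" "K\<^sub>0 \<subseteq> K" "K \<subseteq> carrier G" "normalises G t K\<^sub>0" "t \<in> carrier G" "x \<in> K\<^sub>0"
  shows "poly_conjugated G K t x"
  by (rule poly_conjugatedI[where f = "\<lambda>n. 1" and F = "K\<^sub>0"])
    (use assms in \<open>auto intro!: poly_bounded_const in_word_products conj_by_int_pow_closed\<close>)

text \<open>For \<open>u = [t, x]\<close>, conjugating \<open>x\<close> by \<open>t^(a+1)\<close>
  gives the conjugate of \<open>u\<close> by \<open>t^a\<close> times the conjugate of
  \<open>x\<close> by \<open>t^a\<close>. So the conjugate of \<open>x\<close> telescopes into
  \<open>x\<close> and \<open>|a|\<close> conjugates of \<open>u\<close> or of its inverse, and the
  degree of the length bound rises by one.\<close>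

lemma poly_conjugated_commutator:
  assumes K: "subgroup K G" and t: "t \<in> carrier G" and x: "x \<in> K"
    and u: "poly_conjugated G K t (commutator G t x)"
  shows "poly_conjugated G K t x"
proof -
  obtain F C d where F: "finite F" "F \<subseteq> K" "\<And>x. x \<in> F \<Longrightarrow> inv x \<in> F" and
    *: "\<And>a::int. conj_by G (t [^] a) (commutator G t x) \<in> word_products G F (C * Suc (nat \<bar>a\<bar>) ^ d)"
    using u K by (rule poly_conjugatedE) blast
  have Kc: "K \<subseteq> carrier G" using K subgroup.subset by blast
  have xc: "x \<in> carrier G" and Fc: "F \<subseteq> carrier G" using x F(2) Kc by auto
  let ?u = "commutator G t x" and ?F = "insert x F"
  have Fc': "?F \<subseteq> carrier G" using Fc xc by auto
  have uc: "?u \<in> carrier G" using t xc by auto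
  \<comment> \<open>One \<open>n\<close> above all \<open>|a|\<close> that occur gives every factor
    of the telescoping product the same length bound, so that lengths add up to a multiple.\<close>
  have bound: "conj_by G (t [^] a) ?u \<in> word_products G ?F (C * Suc n ^ d)"
    "inv (conj_by G (t [^] a) ?u) \<in> word_products G ?F (C * Suc n ^ d)"
    if "nat \<bar>a\<bar> \<le> n" for a :: int and n
  proof -
    have "C * Suc (nat \<bar>a\<bar>) ^ d \<le> C * Suc n ^ d" using that by (simp add: power_mono)
    then have "word_products G F (C * Suc (nat \<bar>a\<bar>) ^ d) \<subseteq> word_products G ?F (C * Suc n ^ d)"
      by (intro word_products_mono) auto
    then show "conj_by G (t [^] a) ?u \<in> word_products G ?F (C * Suc n ^ d)"
      "inv (conj_by G (t [^] a) ?u) \<in> word_products G ?F (C * Suc n ^ d)"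
      using *[of a] word_products_inv[OF Fc F(3) *[of a]] by auto
  qed
  have step: "conj_by G (t [^] (a + 1)) x = conj_by G (t [^] a) ?u \<otimes> conj_by G (t [^] a) x" for a :: int
  proof -
    have "conj_by G (t [^] (a + 1)) x = conj_by G (t [^] a) (conj_by G t x)"
      using t xc by (simp add: conj_by_conj_by int_pow_mult)
    then show ?thesis
      using t xc uc by (simp add: conj_by_eq_commutator[OF t xc] conj_by_mult)
  qed
  \<comment> \<open>The leading \<open>1\<close> counts the letter \<open>x\<close>, which is why
    \<open>x\<close> is put into \<open>?F\<close>.\<close>
  have pos: "conj_by G (t [^] int m) x \<in> word_products G ?F (1 + m * (C * Suc n ^ d))"
    if "m \<le> n" for m n
    using that
  proof (induction m)
    case 0
    then show ?case using xc Fc' by (auto intro!: in_word_products)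
  next
    case (Suc m)
    have "conj_by G (t [^] int m) ?u \<otimes> conj_by G (t [^] int m) x
        \<in> word_products G ?F (C * Suc n ^ d + (1 + m * (C * Suc n ^ d)))"
      by (rule word_products_mult[OF Fc' bound(1)]) (use Suc in auto)
    moreover have "C * Suc n ^ d + (1 + m * (C * Suc n ^ d)) = 1 + Suc m * (C * Suc n ^ d)" by simp
    moreover have "int (Suc m) = int m + 1" by simp
    ultimately show ?case by (simp only: step[of "int m"])
  qed
  have neg: "conj_by G (t [^] (- int m)) x \<in> word_products G ?F (1 + m * (C * Suc n ^ d))"
    if "m \<le> n" for m n
    using that
  proof (induction m)
    case 0
    then show ?case using xc Fc' by (auto intro!: in_word_products)
  next
    case (Suc m)
    let ?b = "- int (Suc m)"
    have e: "conj_by G (t [^] (- int m)) x = conj_by G (t [^] ?b) ?u \<otimes> conj_by G (t [^] ?b) x"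
      using step[of ?b] by (simp add: algebra_simps)
    \<comment> \<open>For negative exponents the recursion is solved for its last factor; this is
      where the letters must be closed under inverses.\<close>
    have "conj_by G (t [^] ?b) x = inv (conj_by G (t [^] ?b) ?u) \<otimes> conj_by G (t [^] (- int m)) x"
      unfolding e by (subst inv_solve_left) (use t xc uc in auto)
    moreover have "inv (conj_by G (t [^] ?b) ?u) \<otimes> conj_by G (t [^] (- int m)) x
        \<in> word_products G ?F (C * Suc n ^ d + (1 + m * (C * Suc n ^ d)))"
      by (rule word_products_mult[OF Fc' bound(2)]) (use Suc in auto)
    moreover have "C * Suc n ^ d + (1 + m * (C * Suc n ^ d)) = 1 + Suc m * (C * Suc n ^ d)" by simp
    ultimately show ?case by (simp only:)
  qed
  show ?thesis
  proof (rule poly_conjugatedI[where F = ?F and f = "\<lambda>n. 1 + n * (C * Suc n ^ d)"])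
    fix a :: int
    show "conj_by G (t [^] a) x \<in> word_products G ?F (1 + nat \<bar>a\<bar> * (C * Suc (nat \<bar>a\<bar>) ^ d))"
    proof (cases "0 \<le> a")
      case True
      then have "int (nat \<bar>a\<bar>) = a" by simp
      then show ?thesis using pos[of "nat \<bar>a\<bar>", OF order_refl] by (simp only:)
    next
      case False
      then have "- int (nat \<bar>a\<bar>) = a" by simp
      then show ?thesis using neg[of "nat \<bar>a\<bar>", OF order_refl] by (simp only:)
    qed
    show "poly_bounded (\<lambda>n. 1 + n * (C * Suc n ^ d))" by (intro poly_bounded_intros)
  qed (use F(1,2) x in auto)
qed

lemma poly_conjugated_iterated_commutator:
  assumes K: "subgroup K G" and t: "t \<in> carrier G" "normalises G t K" and x: "x \<in> K"
    and u: "poly_conjugated G K t ((commutator G t ^^ n) x)"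
  shows "poly_conjugated G K t x"
  using x u
proof (induction n arbitrary: x)
  case (Suc n)
  have "commutator G t x = conj_by G t x \<otimes> inv x" by (simp add: commutator_def conj_by_def)
  then have "commutator G t x \<in> K"
    using Suc.prems K t by (auto simp: normalises_def subgroup.m_closed subgroup.m_inv_closed)
  then have "poly_conjugated G K t (commutator G t x)"
    using Suc by (simp add: funpow_Suc_right del: funpow.simps)
  then show ?case using K t Suc.prems by (blast intro: poly_conjugated_commutator)
qed simp

text \<open>Write \<open>a = r + e q\<close> with \<open>0 \<le> r < e\<close>. Conjugation by
  \<open>t^r\<close> is a homomorphism, so it turns a word for \<open>q\<close> into one of the same
  length in conjugated letters, and only finitely many \<open>r\<close> occur.\<close>

lemma poly_conjugated_pow:
  assumes K: "subgroup K G" and t: "t \<in> carrier G" "normalises G t K" and x: "x \<in> K"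
    and e: "0 < e" and u: "poly_conjugated G K (t [^] (e::nat)) x"
  shows "poly_conjugated G K t x"
proof -
  obtain F C d where F: "finite F" "F \<subseteq> K" and
    *: "\<And>a::int. conj_by G ((t [^] e) [^] a) x \<in> word_products G F (C * Suc (nat \<bar>a\<bar>) ^ d)"
    using u unfolding poly_conjugated_def by blast
  have Kc: "K \<subseteq> carrier G" using K subgroup.subset by blast
  then have xc: "x \<in> carrier G" and Fc: "F \<subseteq> carrier G" using x F(2) Kc by auto
  let ?F = "\<Union>r\<in>{0..<int e}. conj_by G (t [^] r) ` F"
  show ?thesis
  proof (rule poly_conjugatedI[where F = ?F and f = "\<lambda>n. C * Suc n ^ d"])
    show "?F \<subseteq> K" using F(2) t Kc by (auto intro!: conj_by_int_pow_closed)
    fix a :: int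
    define q r where "q = a div int e" and "r = a mod int e"
    have a: "a = r + int e * q" unfolding q_def r_def by simp
    have r: "r \<in> {0..<int e}" unfolding r_def using e by auto
    \<comment> \<open>For negative \<open>a\<close> the quotient is rounded down, but it still lies
      between \<open>a\<close> and \<open>0\<close>.\<close>
    have q: "nat \<bar>q\<bar> \<le> nat \<bar>a\<bar>"
    proof -
      have "\<bar>a div int e\<bar> \<le> \<bar>a\<bar>"
        using e zdiv_mono2[of a 1 "int e"] zdiv_mono2_neg[of a 1 "int e"]
          pos_imp_zdiv_nonneg_iff[of "int e" a] by (cases "0 \<le> a") auto
      then show ?thesis unfolding q_def by simp
    qed
    have "(t [^] e) [^] q = t [^] (int e * q)"
      using t int_pow_pow[of t "int e" q] by (simp add: int_pow_int)
    then have "conj_by G (t [^] a) x = conj_by G (t [^] r) (conj_by G ((t [^] e) [^] q) x)"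
      using t xc by (simp add: a conj_by_conj_by int_pow_mult)
    moreover have "\<dots> \<in> word_products G (conj_by G (t [^] r) ` F) (C * Suc (nat \<bar>q\<bar>) ^ d)"
      using t by (intro word_products_conj_by[OF Fc *]) auto
    moreover have "word_products G (conj_by G (t [^] r) ` F) (C * Suc (nat \<bar>q\<bar>) ^ d)
        \<subseteq> word_products G ?F (C * Suc (nat \<bar>a\<bar>) ^ d)"
      using r q by (intro word_products_mono mult_le_mono2 power_mono) auto
    ultimately show "conj_by G (t [^] a) x \<in> word_products G ?F (C * Suc (nat \<bar>a\<bar>) ^ d)" by auto
  qed (use F in \<open>auto intro!: poly_bounded_intros\<close>)
qed

section \<open>Growth of cyclic and of finite extensions\<close>

lemma generate_insert_normalised:
  assumes K: "subgroup K G" and t: "t \<in> carrier G" "normalises G t K"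
    and g: "g \<in> generate G (insert t K)"
  shows "\<exists>k\<in>K. \<exists>a::int. g = k \<otimes> t [^] a"
proof -
  have Kc: "K \<subseteq> carrier G" using K subgroup.subset by blast
  show ?thesis using g
  proof (induction g rule: generate.induct)
    case one
    then show ?case using K by (auto intro!: bexI[of _ \<one>] exI[of _ 0] simp: subgroup.one_closed)
  next
    case (incl h)
    show ?case
    proof (cases "h = t")
      case True
      then show ?thesis using K t by (auto intro!: bexI[of _ \<one>] exI[of _ 1] simp: subgroup.one_closed)
    next
      case False
      then show ?thesis using incl Kc by (auto intro!: bexI[of _ h] exI[of _ 0])
    qed
  next
    case (inv h)
    show ?case
    proof (cases "h = t")
      case True
      then show ?thesis using K t
        by (auto intro!: bexI[of _ \<one>] exI[of _ "-1"] simp: subgroup.one_closed int_pow_neg)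
    next
      case False
      then show ?thesis using inv Kc K
        by (auto intro!: bexI[of _ "inv h"] exI[of _ 0] simp: subgroup.m_inv_closed)
    qed
  next
    case (eng g h)
    then obtain k l a b where g: "k \<in> K" "g = k \<otimes> t [^] (a::int)" and h: "l \<in> K" "h = l \<otimes> t [^] (b::int)"
      by auto
    have m: "conj_by G (t [^] a) l \<in> K" by (rule conj_by_int_pow_closed) (use t Kc h in auto)
    have "g \<otimes> h = k \<otimes> (t [^] a \<otimes> l) \<otimes> t [^] b"
      using g h t Kc by (simp add: m_assoc subset_iff)
    also have "t [^] a \<otimes> l = conj_by G (t [^] a) l \<otimes> t [^] a"
      using h t Kc by (intro mult_eq_conj_by_mult) auto
    also have "k \<otimes> \<dots> \<otimes> t [^] b = (k \<otimes> conj_by G (t [^] a) l) \<otimes> t [^] (a + b)"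
      using g h t Kc m by (simp add: m_assoc subset_iff int_pow_mult)
    finally show ?case using m g K by (auto intro!: bexI[of _ "k \<otimes> conj_by G (t [^] a) l"] simp: subgroup.m_closed)
  qed
qed

text \<open>Each letter has the form \<open>k t^b\<close> with \<open>k\<close> in \<open>K\<close>.
  In a word of length \<open>n\<close>, pushing the powers of \<open>t\<close> to the right
  conjugates the \<open>K\<close>-parts by powers of exponent at most \<open>E n\<close>. The result
  is \<open>y t^b\<close>, with \<open>y\<close> a word of polynomial length in finitely many
  letters of \<open>K\<close>; the growth of \<open>K\<close> counts the \<open>y\<close>, and at
  most \<open>2 E n + 1\<close> exponents remain.\<close>

lemma poly_growth_on_generate_insert:
  assumes K: "subgroup K G" and t: "t \<in> carrier G" "normalises G t K"
    and growth: "poly_growth_on G K" and poly: "\<And>x. x \<in> K \<Longrightarrow> poly_conjugated G K t x"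
  shows "poly_growth_on G (generate G (insert t K))"
  unfolding poly_growth_on_def
proof (intro allI impI; elim conjE)
  fix F assume F: "finite F" "F \<subseteq> generate G (insert t K)"
  have Kc: "K \<subseteq> carrier G" using K subgroup.subset by blast
  have "\<forall>f\<in>F. \<exists>p. fst p \<in> K \<and> f = fst p \<otimes> t [^] (snd p :: int)"
    using generate_insert_normalised[OF K t] F(2) by fastforce
  then obtain p where p: "\<And>f. f \<in> F \<Longrightarrow> fst (p f) \<in> K" "\<And>f. f \<in> F \<Longrightarrow> f = fst (p f) \<otimes> t [^] (snd (p f) :: int)"
    by metis
  have "\<forall>f\<in>F. \<exists>P C d. finite P \<and> P \<subseteq> K \<and>
     (\<forall>a::int. conj_by G (t [^] a) (fst (p f)) \<in> word_products G P (C * Suc (nat \<bar>a\<bar>) ^ d))"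
    using poly p(1) unfolding poly_conjugated_def by blast
  then obtain P C d where P: "\<And>f. f \<in> F \<Longrightarrow> finite (P f)" "\<And>f. f \<in> F \<Longrightarrow> P f \<subseteq> K"
     "\<And>f (a::int). f \<in> F \<Longrightarrow> conj_by G (t [^] a) (fst (p f)) \<in> word_products G (P f) (C f * Suc (nat \<bar>a\<bar>) ^ d f)"
    by metis
  \<comment> \<open>Common data for all letters of \<open>F\<close>: \<open>Q\<close> contains all
    auxiliary letters, and the sums \<open>c\<close> and \<open>E\<close> stand in for the maxima of
    the length bounds and of the exponents.\<close>
  define Q where "Q = \<Union> (P ` F)"
  define c where "c = (\<lambda>n. \<Sum>f\<in>F. C f * Suc n ^ d f)"
  define E where "E = (\<Sum>f\<in>F. nat \<bar>snd (p f)\<bar>)"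
  have Q: "finite Q" "Q \<subseteq> K" using P F by (auto simp: Q_def)
  then have Qc: "Q \<subseteq> carrier G" using Kc by auto
  have c: "poly_bounded c" unfolding c_def
    using F(1) by (induction F) (auto intro!: poly_bounded_intros)
  have E: "\<bar>snd (p f)\<bar> \<le> int E" if "f \<in> F" for f
    using member_le_sum[OF that, of "\<lambda>f. nat \<bar>snd (p f)\<bar>"] F(1) unfolding E_def by linarith
  have conj: "conj_by G (t [^] a) (fst (p f)) \<in> word_products G Q (c n)"
    if "f \<in> F" "nat \<bar>a\<bar> \<le> n" for f n and a :: int
  proof -
    have "C f * Suc (nat \<bar>a\<bar>) ^ d f \<le> C f * Suc n ^ d f" using that by (simp add: power_mono)
    also have "\<dots> \<le> c n" unfolding c_def
      using member_le_sum[OF that(1), of "\<lambda>f. C f * Suc n ^ d f"] F(1) by auto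
    finally have "word_products G (P f) (C f * Suc (nat \<bar>a\<bar>) ^ d f) \<subseteq> word_products G Q (c n)"
      using that by (intro word_products_mono) (auto simp: Q_def)
    then show ?thesis using P(3)[OF that(1), of a] by auto
  qed
  \<comment> \<open>\<open>a\<close> is the exponent already carried to this position. The budget of
    \<open>|a|\<close> plus \<open>E\<close> per remaining letter keeps every later exponent within
    \<open>n\<close>, so \<open>c n\<close> serves for each letter.\<close>
  have word: "\<exists>y\<in>word_products G Q (length ws * c n). \<exists>b. \<bar>b\<bar> \<le> int n \<and>
      t [^] a \<otimes> foldr (\<otimes>) ws \<one> = y \<otimes> t [^] (b::int)"
    if "set ws \<subseteq> F" "\<bar>a\<bar> + int E * int (length ws) \<le> int n" for ws n and a :: int
    using that
  proof (induction ws arbitrary: a)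
    case Nil
    then show ?case using t by (auto intro!: bexI[of _ \<one>] exI[of _ a] simp: one_in_word_products)
  next
    case (Cons f ws)
    have f: "f \<in> F" using Cons by auto
    have ws: "foldr (\<otimes>) ws \<one> \<in> carrier G"
      using Cons.prems F(2) generate_in_carrier[of "insert t K"] t Kc by (auto intro!: foldr_mult_closed)
    have "\<bar>a + snd (p f)\<bar> + int E * int (length ws) \<le> int n"
      using Cons.prems E[OF f] by (simp add: algebra_simps)
    then obtain y b where y: "y \<in> word_products G Q (length ws * c n)" "\<bar>b\<bar> \<le> int n"
      "t [^] (a + snd (p f)) \<otimes> foldr (\<otimes>) ws \<one> = y \<otimes> t [^] (b::int)"
      using Cons by (metis insert_subset list.simps(15))
    have z: "conj_by G (t [^] a) (fst (p f)) \<in> word_products G Q (c n)"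
    proof (rule conj[OF f])
      have "0 \<le> int E * int (length (f # ws))" by simp
      then show "nat \<bar>a\<bar> \<le> n" using Cons.prems(2) by linarith
    qed
    have kc: "fst (p f) \<in> carrier G" using p(1)[OF f] Kc by auto
    have yc: "y \<in> carrier G" using y(1) word_products_closed[OF Qc] by auto
    have "t [^] a \<otimes> foldr (\<otimes>) (f # ws) \<one> = t [^] a \<otimes> (fst (p f) \<otimes> t [^] snd (p f) \<otimes> foldr (\<otimes>) ws \<one>)"
      using p(2)[OF f] by simp
    also have "\<dots> = (t [^] a \<otimes> fst (p f)) \<otimes> t [^] snd (p f) \<otimes> foldr (\<otimes>) ws \<one>"
      using t kc ws by (simp add: m_assoc)
    also have "t [^] a \<otimes> fst (p f) = conj_by G (t [^] a) (fst (p f)) \<otimes> t [^] a"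
      using t kc by (intro mult_eq_conj_by_mult) auto
    also have "\<dots> \<otimes> t [^] snd (p f) \<otimes> foldr (\<otimes>) ws \<one>
        = conj_by G (t [^] a) (fst (p f)) \<otimes> (t [^] (a + snd (p f)) \<otimes> foldr (\<otimes>) ws \<one>)"
      using t kc ws by (simp add: m_assoc int_pow_mult)
    also have "\<dots> = (conj_by G (t [^] a) (fst (p f)) \<otimes> y) \<otimes> t [^] b"
      using t kc yc y(3) by (simp add: m_assoc)
    finally show ?case
      using word_products_mult[OF Qc z y(1)] y(2)
      by (auto intro!: bexI[of _ "conj_by G (t [^] a) (fst (p f)) \<otimes> y"] exI[of _ b])
  qed
  have "card (word_products G F n)
      \<le> card (word_products G Q (n * c (E * n))) * (2 * (E * n) + 1)" (is "_ \<le> ?r n") for n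
  proof -
    let ?A = "word_products G Q (n * c (E * n)) \<times> {- int (E * n)..int (E * n)}"
    have "word_products G F n \<subseteq> (\<lambda>(y, b). y \<otimes> t [^] b) ` ?A"
    proof
      fix x assume "x \<in> word_products G F n"
      then obtain ws where ws: "x = foldr (\<otimes>) ws \<one>" "set ws \<subseteq> F" "length ws \<le> n"
        unfolding word_products_def by auto
      have xc: "x \<in> carrier G"
        unfolding ws using ws F(2) generate_in_carrier[of "insert t K"] t Kc by (auto intro!: foldr_mult_closed)
      have "\<bar>0\<bar> + int E * int (length ws) \<le> int (E * n)" using ws(3) by (simp add: mult_left_mono)
      then obtain y b where y: "y \<in> word_products G Q (length ws * c (E * n))" "\<bar>b\<bar> \<le> int (E * n)"
          "t [^] (0::int) \<otimes> x = y \<otimes> t [^] b"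
        using word[OF ws(2), of 0 "E * n"] ws(1) by auto
      have "y \<in> word_products G Q (n * c (E * n))"
        using y(1) ws(3) word_products_mono[of Q Q "length ws * c (E * n)" "n * c (E * n)"] by auto
      then show "x \<in> (\<lambda>(y, b). y \<otimes> t [^] b) ` ?A"
        using y xc by (auto intro!: image_eqI[of _ _ "(y, b)"])
    qed
    moreover have fin: "finite ?A" using finite_word_products[OF Q(1)] by auto
    ultimately have "card (word_products G F n) \<le> card ?A" by (rule surj_card_le[rotated])
    also have "card ?A = ?r n" by (simp add: card_cartesian_product nat_add_distrib nat_mult_distrib)
    finally show ?thesis .
  qed
  moreover have "poly_bounded ?r"
  proof -
    have "poly_bounded (\<lambda>n. card (word_products G Q n))"
      using growth Q unfolding poly_growth_on_def by auto
    moreover have "poly_bounded (\<lambda>n. n * c (E * n))"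
      by (rule poly_bounded_mult[OF poly_bounded_id poly_bounded_compose[OF c]])
        (intro poly_bounded_intros)
    ultimately have "poly_bounded (\<lambda>n. card (word_products G Q (n * c (E * n))))"
      by (rule poly_bounded_compose)
    moreover have "poly_bounded (\<lambda>n. 2 * (E * n) + 1)" by (intro poly_bounded_intros)
    ultimately show ?thesis by (rule poly_bounded_mult)
  qed
  ultimately show "poly_bounded (\<lambda>n. card (word_products G F n))"
    by (rule poly_bounded_mono[rotated])
qed

text \<open>Schreier rewriting: \<open>c f = m c'\<close> moves a representative through the word
  and leaves one letter of \<open>M\<close> behind per letter read. The length is kept, and only the
  final representative has to be recorded.\<close>

lemma poly_growth_on_finite_cover:
  assumes M: "subgroup M G" and C: "finite C" "C \<subseteq> carrier G"
    and cover: "\<And>g. g \<in> carrier G \<Longrightarrow> \<exists>m\<in>M. \<exists>c\<in>C. g = m \<otimes> c"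
    and growth: "poly_growth_on G M"
  shows "poly_growth_on G (carrier G)"
  unfolding poly_growth_on_def
proof (intro allI impI; elim conjE)
  fix F assume F: "finite F" "F \<subseteq> carrier G"
  have Mc: "M \<subseteq> carrier G" using M subgroup.subset by blast
  \<comment> \<open>Some representative is needed to start with, and \<open>\<one>\<close> may not
    be one; so \<open>c0 \<otimes> x\<close> is rewritten and \<open>c0\<close> is cancelled at the
    end.\<close>
  obtain c0 where c0: "c0 \<in> C" using cover[of \<one>] by auto
  have "\<forall>c\<in>C. \<forall>f\<in>F. \<exists>m. m \<in> M \<and> (\<exists>c'\<in>C. c \<otimes> f = m \<otimes> c')"
    using cover C F by (metis m_closed subsetD)
  then obtain m where m: "\<And>c f. c \<in> C \<Longrightarrow> f \<in> F \<Longrightarrow> m c f \<in> M"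
     "\<And>c f. c \<in> C \<Longrightarrow> f \<in> F \<Longrightarrow> \<exists>c'\<in>C. c \<otimes> f = m c f \<otimes> c'" by metis
  define Q where "Q = (\<lambda>(c, f). m c f) ` (C \<times> F)"
  have Q: "finite Q" "Q \<subseteq> M" using C F m by (auto simp: Q_def)
  then have Qc: "Q \<subseteq> carrier G" using Mc by auto
  have word: "\<exists>y\<in>word_products G Q (length ws). \<exists>c'\<in>C. c \<otimes> foldr (\<otimes>) ws \<one> = y \<otimes> c'"
    if "set ws \<subseteq> F" "c \<in> C" for ws c
    using that
  proof (induction ws arbitrary: c)
    case Nil
    then have "\<one> \<in> word_products G Q 0" "c \<otimes> foldr (\<otimes>) [] \<one> = \<one> \<otimes> c"
      using C by (auto simp: one_in_word_products)
    then show ?case using Nil by (metis list.size(3))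
  next
    case (Cons f ws)
    obtain c1 where c1: "c1 \<in> C" "c \<otimes> f = m c f \<otimes> c1" using m(2)[of c f] Cons by auto
    obtain y c' where y: "y \<in> word_products G Q (length ws)" "c' \<in> C" "c1 \<otimes> foldr (\<otimes>) ws \<one> = y \<otimes> c'"
      using Cons c1 by (metis insert_subset list.simps(15))
    have q: "m c f \<in> word_products G Q 1"
      using Cons Qc by (intro in_word_products) (auto simp: Q_def)
    have cs: "c \<in> carrier G" "f \<in> carrier G" "c1 \<in> carrier G" "c' \<in> carrier G" "m c f \<in> carrier G"
      "y \<in> carrier G" "foldr (\<otimes>) ws \<one> \<in> carrier G"
      using Cons C F c1 y(2) m(1) Mc subsetD[OF word_products_closed[OF Qc] y(1)]
      by (auto intro!: foldr_mult_closed)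
    have "c \<otimes> foldr (\<otimes>) (f # ws) \<one> = m c f \<otimes> y \<otimes> c'"
      using cs c1(2) y(3) by (simp flip: m_assoc) (simp add: m_assoc)
    then show ?case using word_products_mult[OF Qc q y(1)] y(2) by auto
  qed
  have "card (word_products G F n) \<le> card (word_products G Q n) * card C" for n
  proof -
    have "word_products G F n \<subseteq> (\<lambda>(y, c). inv c0 \<otimes> (y \<otimes> c)) ` (word_products G Q n \<times> C)"
    proof
      fix x assume "x \<in> word_products G F n"
      then obtain ws where ws: "x = foldr (\<otimes>) ws \<one>" "set ws \<subseteq> F" "length ws \<le> n"
        unfolding word_products_def by auto
      obtain y c where y: "y \<in> word_products G Q (length ws)" "c \<in> C" "c0 \<otimes> x = y \<otimes> c"
        using word[OF ws(2) c0] ws(1) by auto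
      have "x \<in> carrier G" unfolding ws using ws F(2) by (auto intro!: foldr_mult_closed)
      then have "x = inv c0 \<otimes> (y \<otimes> c)" using y(3) c0 C by (metis inv_closed l_inv l_one m_assoc subsetD)
      moreover have "y \<in> word_products G Q n" using y(1) ws(3) word_products_mono[of Q Q] by auto
      ultimately show "x \<in> (\<lambda>(y, c). inv c0 \<otimes> (y \<otimes> c)) ` (word_products G Q n \<times> C)" using y(2) by auto
    qed
    moreover have "finite (word_products G Q n \<times> C)" using finite_word_products[OF Q(1)] C by auto
    ultimately have "card (word_products G F n) \<le> card (word_products G Q n \<times> C)"
      by (rule surj_card_le[rotated])
    then show ?thesis by (simp add: card_cartesian_product)
  qed
  moreover have "poly_bounded (\<lambda>n. card (word_products G Q n) * card C)"
    using growth Q unfolding poly_growth_on_def by (auto intro!: poly_bounded_intros)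
  ultimately show "poly_bounded (\<lambda>n. card (word_products G F n))"
    by (rule poly_bounded_mono[rotated])
qed

end

section \<open>Central series and polycyclic groups\<close>

text \<open>\<open>t\<close> may have finite or infinite order modulo \<open>K\<close>. The class is
  closed under subgroups, which finite generation alone is not; this is what makes the groups
  \<open>Ns h\<close> finitely generated.\<close>

inductive polycyclic :: "('a, 'b) monoid_scheme \<Rightarrow> 'a set \<Rightarrow> bool" for G where
  trivial: "polycyclic G {\<one>\<^bsub>G\<^esub>}"
| extend: "\<lbrakk>polycyclic G K; t \<in> carrier G; normalises G t K\<rbrakk> \<Longrightarrow> polycyclic G (generate G (insert t K))"

context group
begin

lemma generate_subgroup_eq: "subgroup K G \<Longrightarrow> generate G K = K"
  using generate_subgroup_incl[of K K] by (auto intro: generate.incl)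

lemma generate_insert_generate:
  assumes "S \<subseteq> carrier G" "t \<in> carrier G"
  shows "generate G (insert t (generate G S)) = generate G (insert t S)"
proof
  have sub: "insert t S \<subseteq> carrier G" using assms by auto
  have "insert t (generate G S) \<subseteq> generate G (insert t S)"
    using mono_generate[of S "insert t S"] by (auto intro: generate.incl)
  then show "generate G (insert t (generate G S)) \<subseteq> generate G (insert t S)"
    by (rule generate_subgroup_incl[OF _ generate_is_subgroup[OF sub]])
  show "generate G (insert t S) \<subseteq> generate G (insert t (generate G S))"
    by (rule mono_generate) (auto intro: generate.incl)
qed

lemma normalises_subgroup:
  assumes "subgroup K G" "t \<in> K" shows "normalises G t K"
  using assms unfolding normalises_def conj_by_def
  by (metis subgroup.m_closed subgroup.m_inv_closed)

lemma normalises_normal: "K \<lhd> G \<Longrightarrow> t \<in> carrier G \<Longrightarrow> normalises G t K"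
  unfolding normalises_def conj_by_def by (metis inv_closed normal.inv_op_closed2)

lemma commutator_one_left [simp]: "x \<in> carrier G \<Longrightarrow> commutator G \<one> x = \<one>"
  by (simp add: commutator_def)

lemma commutator_one_right [simp]: "x \<in> carrier G \<Longrightarrow> commutator G x \<one> = \<one>"
  by (simp add: commutator_def)

lemma commutator_mult_left:
  "\<lbrakk>g \<in> carrier G; h \<in> carrier G; x \<in> carrier G\<rbrakk>
    \<Longrightarrow> commutator G (g \<otimes> h) x = conj_by G g (commutator G h x) \<otimes> commutator G g x"
  by (simp add: commutator_def conj_by_def m_assoc inv_mult_group inv_solve_left'
      flip: m_assoc[of "inv g" g] m_assoc[of "inv x" x])

lemma commutator_inv_left:
  "\<lbrakk>g \<in> carrier G; x \<in> carrier G\<rbrakk>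
    \<Longrightarrow> commutator G (inv g) x = conj_by G (inv g) (inv (commutator G g x))"
  by (simp add: commutator_def conj_by_def m_assoc inv_mult_group)

lemma commutator_mult_right:
  "\<lbrakk>g \<in> carrier G; x \<in> carrier G; y \<in> carrier G\<rbrakk>
    \<Longrightarrow> commutator G g (x \<otimes> y) = commutator G g x \<otimes> conj_by G x (commutator G g y)"
  by (simp add: commutator_def conj_by_def m_assoc inv_mult_group
      flip: m_assoc[of "inv g" g] m_assoc[of "inv x" x])

lemma commutator_inv_right:
  "\<lbrakk>g \<in> carrier G; x \<in> carrier G\<rbrakk>
    \<Longrightarrow> commutator G g (inv x) = conj_by G (inv x) (inv (commutator G g x))"
  by (simp add: commutator_def conj_by_def m_assoc inv_mult_group flip: m_assoc[of "inv x" x])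

text \<open>By \<open>[g h, y] = g [h, y] g^-1 [g, y]\<close>, the elements of
  \<open>generate G U\<close> whose commutator with \<open>y\<close> lies in \<open>Q\<close> form a
  subgroup once \<open>generate G U\<close> conjugates \<open>Q\<close> into itself.\<close>

lemma commutator_generate_left:
  assumes U: "U \<subseteq> carrier G" and y: "y \<in> carrier G" and Q: "subgroup Q G"
    and norm: "\<And>g q. g \<in> generate G U \<Longrightarrow> q \<in> Q \<Longrightarrow> conj_by G g q \<in> Q"
    and comm: "\<And>x. x \<in> U \<Longrightarrow> commutator G x y \<in> Q" and n: "n \<in> generate G U"
  shows "commutator G n y \<in> Q"
  using n
proof (induction n rule: generate.induct)
  case (eng g h)
  then have "g \<in> carrier G" "h \<in> carrier G" using U generate_in_carrier by auto
  then show ?case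
    using eng norm y Q by (simp add: commutator_mult_left subgroup.m_closed)
next
  case (inv h)
  then show ?case
    using norm[of "inv h"] comm U y Q
    by (subst commutator_inv_left) (auto intro!: norm generate.inv subgroup.m_inv_closed)
qed (use comm Q y in \<open>auto simp: subgroup.one_closed\<close>)

lemma commutator_generate_right:
  assumes U: "U \<subseteq> carrier G" and y: "y \<in> carrier G" and Q: "subgroup Q G"
    and norm: "\<And>g q. g \<in> generate G U \<Longrightarrow> q \<in> Q \<Longrightarrow> conj_by G g q \<in> Q"
    and comm: "\<And>x. x \<in> U \<Longrightarrow> commutator G y x \<in> Q" and n: "n \<in> generate G U"
  shows "commutator G y n \<in> Q"
  using n
proof (induction n rule: generate.induct)
  case (eng g h)
  then have "g \<in> carrier G" "h \<in> carrier G" using U generate_in_carrier by auto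
  then show ?case
    using eng norm y Q by (simp add: commutator_mult_right subgroup.m_closed)
next
  case (inv h)
  then show ?case
    using norm[of "inv h"] comm U y Q
    by (subst commutator_inv_right) (auto intro!: norm generate.inv subgroup.m_inv_closed)
qed (use comm Q y in \<open>auto simp: subgroup.one_closed\<close>)

text \<open>Every subgroup \<open>K\<close> between \<open>M (Suc i)\<close> and \<open>M i\<close>
  is normalised by \<open>M 0\<close>, because \<open>g x g^-1 = [g, x] x\<close> and
  \<open>[g, x]\<close> lies in \<open>M (Suc i)\<close>. The principle serves twice: from the
  trivial group up the lower central series of \<open>N\<close>, and from \<open>N\<close> up the
  preimages of the lower central series of \<open>H\<close>.\<close>

lemma central_series_induct [consumes 6, case_names base step]:
  fixes M A :: "nat \<Rightarrow> 'a set"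
  assumes M: "\<And>i. i \<le> s \<Longrightarrow> subgroup (M i) G"
    and desc: "\<And>i. i < s \<Longrightarrow> M (Suc i) \<subseteq> M i"
    and comm: "\<And>i x y. \<lbrakk>i < s; x \<in> M 0; y \<in> M i\<rbrakk> \<Longrightarrow> commutator G x y \<in> M (Suc i)"
    and fin: "\<And>i. i < s \<Longrightarrow> finite (A i)" and sub: "\<And>i. i < s \<Longrightarrow> A i \<subseteq> M i"
    and gen: "\<And>i. i < s \<Longrightarrow> M i = generate G (M (Suc i) \<union> A i)"
    and base: "P (M s)"
    and step: "\<And>K t i. \<lbrakk>subgroup K G; M s \<subseteq> K; K \<subseteq> M 0; i < s; t \<in> A i; normalises G t K; P K\<rbrakk>
      \<Longrightarrow> P (generate G (insert t K))"
  shows "P (M 0)"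
proof -
  have mono: "M j \<subseteq> M i" if "i \<le> j" "j \<le> s" for i j
    using that
  proof (induction j rule: dec_induct)
    case (step n)
    then show ?case using desc[of n] by simp
  qed simp
  have carr: "M i \<subseteq> carrier G" if "i \<le> s" for i using M[OF that] subgroup.subset by blast
  show ?thesis
  proof (rule inc_induct[of 0 s])
    fix i assume i: "i < s" "P (M (Suc i))"
    have sc: "M (Suc i) \<union> A i \<subseteq> carrier G"
      using carr[of i] sub[OF i(1)] desc[OF i(1)] i(1) by auto
    have "P (generate G (M (Suc i) \<union> B))" if "finite B" "B \<subseteq> A i" for B
      using that
    proof (induction B rule: finite_subset_induct')
      case empty
      then show ?case using i M[of "Suc i"] by (simp add: generate_subgroup_eq)
    next
      case (insert t B)
      let ?K = "generate G (M (Suc i) \<union> B)"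
      have Bc: "M (Suc i) \<union> B \<subseteq> carrier G" using sc insert by auto
      have K: "subgroup ?K G" by (rule generate_is_subgroup[OF Bc])
      have K1: "M (Suc i) \<subseteq> ?K" by (auto intro: generate.incl)
      have K2: "?K \<subseteq> M i"
        unfolding gen[OF i(1)] using insert by (intro mono_generate) auto
      have ti: "t \<in> M i" using insert sub i(1) by auto
      have t0: "t \<in> M 0" using ti mono[of 0 i] i by auto
      have tc: "t \<in> carrier G" using t0 carr[of 0] by auto
      have "conj_by G g x \<in> ?K" if "g \<in> M 0" "x \<in> ?K" for g x
      proof -
        have "commutator G g x \<in> ?K" using comm[OF i(1) that(1)] that(2) K1 K2 by blast
        then show ?thesis
          using that K carr[of 0] subgroup.subset[OF K]
          by (subst conj_by_eq_commutator) (auto simp: subgroup.m_closed)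
      qed
      then have nt: "normalises G t ?K"
        using t0 subgroup.m_inv_closed[OF M[of 0]] by (simp add: normalises_def)
      have "P (generate G (insert t ?K))"
        using K nt i(1) insert K1 K2 mono[of "Suc i" s] mono[of 0 i]
        by (intro step[where i = i]) auto
      then show ?case using generate_insert_generate[OF Bc tc] by simp
    qed
    then show "P (M i)" using fin i(1) gen by (metis order_refl)
  qed (use base in auto)
qed

section \<open>The lower central series and finitely generated nilpotent groups\<close>

lemma commutator_in_commutator_subgroup:
  "x \<in> H \<Longrightarrow> y \<in> K \<Longrightarrow> commutator G x y \<in> commutator_subgroup G H K"
  unfolding commutator_subgroup_def commutator_def by (auto intro: generate.incl)

lemma commutator_subgroup_subset:
  assumes "subgroup Q G" "\<And>x y. x \<in> H \<Longrightarrow> y \<in> K \<Longrightarrow> commutator G x y \<in> Q"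
  shows "commutator_subgroup G H K \<subseteq> Q"
  unfolding commutator_subgroup_def
  by (rule generate_subgroup_incl) (use assms in \<open>auto simp: commutator_def\<close>)

lemma commutator_subgroup_is_subgroup:
  "H \<subseteq> carrier G \<Longrightarrow> K \<subseteq> carrier G \<Longrightarrow> subgroup (commutator_subgroup G H K) G"
  unfolding commutator_subgroup_def by (rule generate_is_subgroup) (auto intro!: m_closed inv_closed)

context
  fixes H assumes H: "subgroup H G"
begin

lemma lower_central_subgroup: "subgroup (lower_central G H i) G"
  by (induction i) (use H in \<open>auto intro!: commutator_subgroup_is_subgroup subgroup.subset\<close>)

lemma lower_central_Suc_subset: "lower_central G H (Suc i) \<subseteq> lower_central G H i"
proof (induction i)
  case 0
  have "commutator G x y \<in> H" if "x \<in> H" "y \<in> H" for x y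
    using that H unfolding commutator_def by (metis subgroup.m_closed subgroup.m_inv_closed)
  then show ?case using commutator_subgroup_subset[OF H] by simp
next
  case (Suc i)
  have "commutator G x y \<in> lower_central G H (Suc i)" if "x \<in> H" "y \<in> lower_central G H (Suc i)" for x y
    using that Suc commutator_in_commutator_subgroup by auto
  then show ?case
    using commutator_subgroup_subset[OF lower_central_subgroup[of "Suc i"]]
    by (simp only: lower_central.simps(2)[of G H "Suc i"]) 
qed

lemma commutator_in_lower_central:
  "x \<in> H \<Longrightarrow> y \<in> lower_central G H i \<Longrightarrow> commutator G x y \<in> lower_central G H (Suc i)"
  by (simp add: commutator_in_commutator_subgroup)

lemma iterated_commutator_in_lower_central:
  "x \<in> H \<Longrightarrow> y \<in> H \<Longrightarrow> (commutator G x ^^ i) y \<in> lower_central G H i"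
  by (induction i) (auto simp: commutator_in_commutator_subgroup)

text \<open>Write \<open>L i\<close> for the terms. Modulo \<open>L (i+2)\<close>, the commutator of
  \<open>H\<close> with \<open>L i\<close> is multiplicative in both arguments and trivial on
  \<open>L (i+1)\<close>. Hence commutators of generators of \<open>H\<close> with generators of
  \<open>L i\<close> modulo \<open>L (i+1)\<close> generate \<open>L (i+1)\<close> modulo
  \<open>L (i+2)\<close>.\<close>

lemma lower_central_finite_generation:
  assumes B: "finite B" "generate G B = H"
  shows "\<exists>A. finite A \<and> A \<subseteq> lower_central G H i \<and>
    lower_central G H i = generate G (lower_central G H (Suc i) \<union> A)"
proof (induction i)
  case 0
  have Bs: "B \<subseteq> H" using B(2) by (auto intro: generate.incl)
  then have "generate G (lower_central G H 1 \<union> B) \<subseteq> H"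
    using lower_central_Suc_subset[of 0] by (intro generate_subgroup_incl[OF _ H]) simp
  moreover have "H \<subseteq> generate G (lower_central G H 1 \<union> B)"
    using B(2) mono_generate[of B "lower_central G H 1 \<union> B"] by auto
  ultimately show ?case using B Bs by (auto intro!: exI[of _ B])
next
  case (Suc i)
  let ?L = "lower_central G H"
  have Hc: "H \<subseteq> carrier G" using H subgroup.subset by blast
  have Lc: "?L j \<subseteq> carrier G" for j using lower_central_subgroup subgroup.subset by blast
  have LH: "?L j \<subseteq> H" for j
    by (induction j) (simp, metis lower_central_Suc_subset subset_trans)
  have Bs: "B \<subseteq> H" using B(2) by (auto intro: generate.incl)
  obtain Y where Y: "finite Y" "Y \<subseteq> ?L i" "?L i = generate G (?L (Suc i) \<union> Y)"
    using Suc by blast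
  define Z where "Z = (\<lambda>(b, y). commutator G b y) ` (B \<times> Y)"
  have Z: "finite Z" "Z \<subseteq> ?L (Suc i)"
    using B Y Bs commutator_in_lower_central by (auto simp: Z_def subset_iff simp del: lower_central.simps)
  let ?Q = "generate G (?L (Suc (Suc i)) \<union> Z)"
  have sub: "?L (Suc (Suc i)) \<union> Z \<subseteq> ?L (Suc i)" using Z lower_central_Suc_subset[of "Suc i"] by auto
  have Q: "subgroup ?Q G" using sub Lc[of "Suc i"] by (intro generate_is_subgroup) auto
  have QL: "?Q \<subseteq> ?L (Suc i)"
    by (rule generate_subgroup_incl[OF sub lower_central_subgroup])
  have L2Q: "?L (Suc (Suc i)) \<subseteq> ?Q" and ZQ: "Z \<subseteq> ?Q" by (auto intro: generate.incl)
  \<comment> \<open>\<open>?Q\<close> lies between two consecutive terms, so conjugation by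
    \<open>H\<close> changes its elements only by commutators that \<open>?Q\<close> already
    contains.\<close>
  have norm: "conj_by G g q \<in> ?Q" if "g \<in> H" "q \<in> ?Q" for g q
  proof -
    have "q \<in> ?L (Suc i)" using QL that(2) by (rule subsetD)
    then have "commutator G g q \<in> ?L (Suc (Suc i))" by (rule commutator_in_lower_central[OF that(1)])
    with L2Q have "commutator G g q \<in> ?Q" by (rule subsetD)
    moreover have "g \<in> carrier G" "q \<in> carrier G"
      using subsetD[OF Hc that(1)] subsetD[OF subgroup.subset[OF Q] that(2)] .
    ultimately show ?thesis
      using subgroup.m_closed[OF Q _ that(2)] by (simp only: conj_by_eq_commutator)
  qed
  have 1: "commutator G n y \<in> ?Q" if "n \<in> H" "y \<in> Y" for n y
  proof (rule commutator_generate_left[of B])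
    show "commutator G b y \<in> ?Q" if "b \<in> B" for b
      using ZQ that \<open>y \<in> Y\<close> by (auto simp only: Z_def)
    show "B \<subseteq> carrier G" "y \<in> carrier G" using Bs Hc Lc[of i] Y(2) that(2) by auto
    show "n \<in> generate G B" using that(1) B(2) by simp
    show "conj_by G g q \<in> ?Q" if "g \<in> generate G B" "q \<in> ?Q" for g q
      using norm[OF _ that(2)] that(1) by (simp only: B(2))
  qed (rule Q)
  \<comment> \<open>The first argument has been extended from \<open>B\<close> to \<open>H\<close>;
    now the second is extended from \<open>Y\<close> to the whole term, where elements of the next
    term contribute commutators two levels down.\<close>
  have "commutator G n y \<in> ?Q" if n: "n \<in> H" and y: "y \<in> ?L i" for n y
  proof (rule commutator_generate_right[of "?L (Suc i) \<union> Y"])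
    show "?L (Suc i) \<union> Y \<subseteq> carrier G" using Lc[of "Suc i"] Lc[of i] Y(2) by blast
    show "commutator G n x \<in> ?Q" if "x \<in> ?L (Suc i) \<union> Y" for x
      using that
    proof
      assume "x \<in> ?L (Suc i)"
      then show ?thesis by (intro subsetD[OF L2Q] commutator_in_lower_central[OF n])
    qed (rule 1[OF n])
    show "conj_by G g q \<in> ?Q" if "g \<in> generate G (?L (Suc i) \<union> Y)" "q \<in> ?Q" for g q
      using norm[OF subsetD[OF LH[of i]] that(2)] that(1) by (simp only: Y(3)[symmetric])
    show "n \<in> carrier G" using n Hc by (rule subsetD[rotated])
    show "y \<in> generate G (?L (Suc i) \<union> Y)" using y by (simp only: Y(3)[symmetric])
  qed (rule Q)
  then have "commutator_subgroup G H (?L i) \<subseteq> ?Q"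
    by (rule commutator_subgroup_subset[OF Q])
  then have "?L (Suc i) = ?Q" using QL by simp
  then show ?case using Z by blast
qed

end

lemma poly_growth_on_trivial: "poly_growth_on G {\<one>}"
  unfolding poly_growth_on_def
proof (intro allI impI; elim conjE)
  fix F assume F: "finite F" "F \<subseteq> {\<one>}"
  have "card (word_products G F n) \<le> card {\<one>}" for n
    by (rule card_mono) (use word_products_subgroup[OF triv_subgroup F(2)] in auto)
  then show "poly_bounded (\<lambda>n. card (word_products G F n))"
    by (intro poly_boundedI[of _ 1 0]) simp
qed

text \<open>One induction gives both claims, as the adjoining step is the rule
  \<open>polycyclic.extend\<close>. For growth, \<open>s\<close>-fold commutation with an element of
  \<open>N\<close> ends in \<open>\<one>\<close>, where the conjugation bound is immediate.\<close>

lemma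
  assumes N: "nilpotent_subgroup G N" and B: "finite B" "generate G B = N"
  shows polycyclic_nilpotent: "polycyclic G N"
    and poly_growth_on_nilpotent: "poly_growth_on G N"
proof -
  obtain s where H: "subgroup N G" and s: "lower_central G N s = {\<one>}"
    using N unfolding nilpotent_subgroup_def by blast
  obtain A where A: "\<And>i. finite (A i)" "\<And>i. A i \<subseteq> lower_central G N i"
    "\<And>i. lower_central G N i = generate G (lower_central G N (Suc i) \<union> A i)"
    using lower_central_finite_generation[OF H B] by metis
  have LN: "lower_central G N i \<subseteq> N" for i
    by (induction i) (simp, metis lower_central_Suc_subset[OF H] subset_trans)
  have Nc: "N \<subseteq> carrier G" using H subgroup.subset by blast
  have "polycyclic G (lower_central G N 0) \<and> poly_growth_on G (lower_central G N 0)"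
  proof (rule central_series_induct[where s = s and A = A and M = "lower_central G N"
        and P = "\<lambda>K. polycyclic G K \<and> poly_growth_on G K"])
    show "polycyclic G (lower_central G N s) \<and> poly_growth_on G (lower_central G N s)"
      unfolding s using poly_growth_on_trivial polycyclic.trivial by blast
    show "commutator G x y \<in> lower_central G N (Suc i)"
      if "x \<in> lower_central G N 0" "y \<in> lower_central G N i" for i x y
      using that by (simp add: commutator_in_commutator_subgroup)
  next
    fix K t i assume K: "subgroup K G" "K \<subseteq> lower_central G N 0" and t: "t \<in> A i" "normalises G t K"
      and P: "polycyclic G K \<and> poly_growth_on G K"
    have tN: "t \<in> N" using t(1) A(2) LN by blast
    have "poly_conjugated G K t x" if x: "x \<in> K" for x
    proof (rule poly_conjugated_iterated_commutator[where n = s])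
      have "(commutator G t ^^ s) x = \<one>"
        using iterated_commutator_in_lower_central[OF H tN, of x s] x K(2) s by auto
      moreover have "poly_conjugated G K t \<one>"
        by (rule poly_conjugated_finite[of "{\<one>}"])
          (use K tN Nc subgroup.one_closed[OF K(1)] subgroup.subset[OF K(1)]
            in \<open>auto simp: normalises_def\<close>)
      ultimately show "poly_conjugated G K t ((commutator G t ^^ s) x)" by simp
    qed (use K t tN Nc x in auto)
    then show "polycyclic G (generate G (insert t K)) \<and> poly_growth_on G (generate G (insert t K))"
      using K t tN P Nc by (auto intro!: polycyclic.extend poly_growth_on_generate_insert)
  qed (rule A lower_central_subgroup[OF H] lower_central_Suc_subset[OF H])+
  then show "polycyclic G N" "poly_growth_on G N" by auto
qed

section \<open>Torsion and subgroups in polycyclic groups\<close>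

lemma polycyclic_subgroup: "polycyclic G K \<Longrightarrow> subgroup K G"
  by (induction rule: polycyclic.induct) (auto intro!: generate_is_subgroup triv_subgroup dest: subgroup.subset)

lemma polycyclic_finitely_generated: "polycyclic G K \<Longrightarrow> \<exists>F. finite F \<and> F \<subseteq> K \<and> generate G F = K"
proof (induction rule: polycyclic.induct)
  case trivial
  then show ?case by (intro exI[of _ "{}"]) (simp add: generate_empty)
next
  case (extend K t)
  then obtain F where F: "finite F" "F \<subseteq> K" "generate G F = K" by blast
  have "F \<subseteq> carrier G" using F(2) polycyclic_subgroup[OF extend(1)] subgroup.subset by blast
  then have "generate G (insert t K) = generate G (insert t F)"
    using generate_insert_generate extend.hyps(2) F(3) by metis
  then show ?case using F by (intro exI[of _ "insert t F"]) (auto intro: generate.incl)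
qed

text \<open>Reducing the exponent in \<open>k t^a\<close> modulo some \<open>n\<close> with
  \<open>t^n = 1\<close> leaves finitely many elements over a finite \<open>K\<close>.\<close>

lemma torsion_polycyclic_finite:
  assumes "polycyclic G K" "\<And>x. x \<in> K \<Longrightarrow> \<exists>n::nat. 0 < n \<and> x [^] n = \<one>"
  shows "finite K"
  using assms
proof (induction rule: polycyclic.induct)
  case (extend K t)
  note K = polycyclic_subgroup[OF extend(1)]
  have "finite K" using extend by (metis generate.incl insertCI)
  obtain n :: nat where n: "0 < n" "t [^] n = \<one>"
    using extend.prems[of t] by (auto intro: generate.incl)
  have "generate G (insert t K) \<subseteq> (\<lambda>(k, r). k \<otimes> t [^] r) ` (K \<times> {0..<int n})"
  proof
    fix g assume "g \<in> generate G (insert t K)"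
    then obtain k and a :: int where k: "k \<in> K" "g = k \<otimes> t [^] a"
      using generate_insert_normalised[OF K extend(2,3)] by blast
    have "t [^] a = t [^] (int n * (a div int n) + a mod int n)" by simp
    also have "\<dots> = (t [^] int n) [^] (a div int n) \<otimes> t [^] (a mod int n)"
      using extend(2) by (simp only: int_pow_mult int_pow_pow)
    also have "\<dots> = t [^] (a mod int n)"
      using n(2) extend(2) by (simp add: int_pow_int)
    finally show "g \<in> (\<lambda>(k, r). k \<otimes> t [^] r) ` (K \<times> {0..<int n})"
      using k n(1) by (intro image_eqI[of _ _ "(k, a mod int n)"]) auto
  qed
  then show ?case using \<open>finite K\<close> by (auto intro: finite_subset)
qed simp

text \<open>The cosets \<open>K t^a\<close> multiply as in a cyclic quotient by \<open>K\<close>,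
  without that quotient being formed; different exponents may give the same coset.\<close>

lemma normalised_coset_mult:
  assumes K: "subgroup K G" and t: "t \<in> carrier G" "normalises G t K"
    and g: "g \<in> K #> (t [^] (a::int))" and h: "h \<in> K #> (t [^] (b::int))"
  shows "g \<otimes> h \<in> K #> (t [^] (a + b))"
proof -
  have Kc: "K \<subseteq> carrier G" using K subgroup.subset by blast
  obtain k l where k: "k \<in> K" "g = k \<otimes> t [^] a" and l: "l \<in> K" "h = l \<otimes> t [^] b"
    using g h by (auto simp: r_coset_def)
  have cs: "k \<in> carrier G" "l \<in> carrier G" using k l Kc by auto
  have m: "conj_by G (t [^] a) l \<in> K" by (rule conj_by_int_pow_closed) (use t Kc l in auto)
  then have mc: "conj_by G (t [^] a) l \<in> carrier G" using Kc by auto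
  have "g \<otimes> h = k \<otimes> (t [^] a \<otimes> l) \<otimes> t [^] b" using k l cs t by (simp add: m_assoc)
  also have "t [^] a \<otimes> l = conj_by G (t [^] a) l \<otimes> t [^] a"
    using cs t by (intro mult_eq_conj_by_mult) auto
  also have "k \<otimes> \<dots> \<otimes> t [^] b = (k \<otimes> conj_by G (t [^] a) l) \<otimes> t [^] (a + b)"
    using cs t mc by (simp add: m_assoc int_pow_mult)
  finally show ?thesis using subgroup.m_closed[OF K k(1) m] by (auto simp: r_coset_def)
qed

lemma normalised_coset_inv:
  assumes K: "subgroup K G" and t: "t \<in> carrier G" "normalises G t K"
    and g: "g \<in> K #> (t [^] (a::int))"
  shows "inv g \<in> K #> (t [^] (- a))"
proof -
  obtain k where k: "k \<in> K" "g = k \<otimes> t [^] a" using g by (auto simp: r_coset_def)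
  have kc: "k \<in> carrier G" using k K subgroup.subset by blast
  have "inv g = t [^] (- a) \<otimes> inv k" using k kc t by (simp add: inv_mult_group int_pow_neg)
  moreover have "t [^] (- a) \<in> K #> (t [^] (- a))" by (rule rcos_self) (use t K in auto)
  moreover have "inv k \<in> K #> (t [^] (0::int))"
    using kc k K by (auto simp: r_coset_def subgroup.m_inv_closed intro!: bexI[of _ "inv k"])
  ultimately show ?thesis using normalised_coset_mult[OF K t, of _ "- a" _ 0] by simp
qed

lemma normalised_coset_nat_pow:
  assumes K: "subgroup K G" and t: "t \<in> carrier G" "normalises G t K"
    and g: "g \<in> K #> (t [^] (a::int))"
  shows "g [^] (n::nat) \<in> K #> (t [^] (a * int n))"
proof (induction n)
  case 0
  then show ?case using subgroup.one_closed[OF K] by (auto simp: r_coset_def intro!: bexI[of _ \<one>])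
next
  case (Suc n)
  then show ?case using normalised_coset_mult[OF K t Suc g] by (simp add: algebra_simps)
qed

lemma normalised_coset_int_pow:
  assumes K: "subgroup K G" and t: "t \<in> carrier G" "normalises G t K"
    and g: "g \<in> K #> (t [^] (a::int))"
  shows "g [^] (q::int) \<in> K #> (t [^] (a * q))"
proof -
  have gc: "g \<in> carrier G" using g r_coset_subset_G[OF subgroup.subset[OF K], of "t [^] a"] t by auto
  show ?thesis
  proof (cases q rule: int_cases2)
    case (nonneg n)
    then show ?thesis using normalised_coset_nat_pow[OF K t g, of n] by (simp add: int_pow_int)
  next
    case (nonpos n)
    then show ?thesis
      using normalised_coset_inv[OF K t normalised_coset_nat_pow[OF K t g, of n]] gc
      by (simp add: int_pow_neg int_pow_int)
  qed
qed

text \<open>As for subgroups of the integers: \<open>L\<close> is generated by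
  \<open>K \<inter> L\<close>, polycyclic by induction, and one element \<open>l\<close> whose coset
  exponent is the least positive one, since a nonzero remainder on division would be
  smaller.\<close>

lemma polycyclic_subset:
  assumes "polycyclic G K" "subgroup L G" "L \<subseteq> K"
  shows "polycyclic G L"
  using assms
proof (induction arbitrary: L rule: polycyclic.induct)
  case trivial
  then have "L = {\<one>}" using subgroup.one_closed by fastforce
  then show ?case by (simp add: polycyclic.trivial)
next
  case (extend K t)
  note K = polycyclic_subgroup[OF extend(1)] and t = extend(2,3) and L = extend.prems(1)
  let ?T = "\<lambda>a::int. K #> (t [^] a)"
  have Kc: "K \<subseteq> carrier G" and Lc: "L \<subseteq> carrier G" using K L subgroup.subset by auto
  have T0: "?T 0 = K" using Kc by simp
  have IH: "polycyclic G (K \<inter> L)"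
    using extend.IH subgroups_Inter_pair[OF K L] by auto
  have cos: "\<exists>a. g \<in> ?T a" if "g \<in> L" for g
    using generate_insert_normalised[OF K t, of g] that extend.prems(2) by (auto simp: r_coset_def)
  show ?case
  proof (cases "\<exists>g\<in>L. \<exists>a. a \<noteq> 0 \<and> g \<in> ?T a")
    case False
    have "g \<in> K" if g: "g \<in> L" for g
    proof -
      obtain a where "g \<in> ?T a" using cos[OF g] ..
      with False g have "g \<in> ?T 0" by metis
      then show ?thesis using T0 by simp
    qed
    then have "L \<subseteq> K" ..
    then show ?thesis using IH by (simp add: inf.absorb2)
  next
    case True
    \<comment> \<open>An element can have several exponents if a power of \<open>t\<close> lies in
      \<open>K\<close>; minimality is therefore taken over all exponents attained by elements of
      \<open>L\<close>.\<close>
    define P where "P = (\<lambda>d::nat. 0 < d \<and> (\<exists>g\<in>L. g \<in> ?T (int d)))"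
    have "\<exists>d. P d"
    proof -
      obtain g a where g: "g \<in> L" "a \<noteq> 0" "g \<in> ?T a" using True by blast
      then show ?thesis
        using normalised_coset_inv[OF K t g(3)] subgroup.m_inv_closed[OF L g(1)]
        by (cases "a > 0") (auto simp: P_def intro!: exI[of _ "nat \<bar>a\<bar>"])
    qed
    define d where "d = (LEAST d. P d)"
    have d: "P d" unfolding d_def using \<open>\<exists>d. P d\<close> by (rule LeastI_ex)
    have least: "\<not> P m" if "m < d" for m using not_less_Least that unfolding d_def by blast
    obtain l where l: "l \<in> L" "l \<in> ?T (int d)" "0 < d" using d by (auto simp: P_def)
    have lc: "l \<in> carrier G" using l Lc by auto
    have conjK: "conj_by G g x \<in> K" if "g \<in> ?T a" "x \<in> K" for g x a
    proof -
      have "x \<in> ?T 0" using that T0 by simp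
      then have "g \<otimes> x \<otimes> inv g \<in> ?T (a + 0 + - a)"
        using that(1) by (intro normalised_coset_mult[OF K t] normalised_coset_inv[OF K t])
      then show ?thesis using T0 by (simp add: conj_by_def)
    qed
    have nl: "normalises G l (K \<inter> L)"
      using conjK[OF l(2)] conjK[OF normalised_coset_inv[OF K t l(2)]] normalises_subgroup[OF L l(1)]
      by (auto simp: normalises_def)
    have "L = generate G (insert l (K \<inter> L))"
    proof
      show "generate G (insert l (K \<inter> L)) \<subseteq> L"
        by (rule generate_subgroup_incl) (use l L in auto)
      show "L \<subseteq> generate G (insert l (K \<inter> L))"
      proof
        fix g assume g: "g \<in> L"
        obtain a where a: "g \<in> ?T a" using cos[OF g] by blast
        let ?q = "a div int d"
        define h where "h = g \<otimes> l [^] (- ?q)"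
        have lq: "l [^] (- ?q) \<in> L" using subgroup_int_pow_closed[OF L l(1)] .
        have "h \<in> ?T (a + int d * (- ?q))"
          unfolding h_def by (intro normalised_coset_mult[OF K t a] normalised_coset_int_pow[OF K t l(2)])
        also have "a + int d * (- ?q) = a mod int d" by (simp add: minus_mult_div_eq_mod)
        finally have hT: "h \<in> ?T (a mod int d)" .
        have hL: "h \<in> L" unfolding h_def using subgroup.m_closed[OF L g lq] .
        have "a mod int d = 0"
        proof (rule ccontr)
          assume "a mod int d \<noteq> 0"
          moreover have "0 \<le> a mod int d" "a mod int d < int d" using l(3) by auto
          ultimately have "P (nat (a mod int d))" "nat (a mod int d) < d"
            using hT hL by (auto simp: P_def)
          then show False using least by blast
        qed
        then have "h \<in> K \<inter> L" using hT hL T0 by simp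
        have "subgroup (generate G (insert l (K \<inter> L))) G"
          by (rule generate_is_subgroup) (use Kc lc in auto)
        moreover have "h \<in> generate G (insert l (K \<inter> L))" "l \<in> generate G (insert l (K \<inter> L))"
          using \<open>h \<in> K \<inter> L\<close> by (auto intro: generate.incl)
        moreover have "g = h \<otimes> l [^] ?q"
          unfolding h_def using g Lc lc by (auto simp: m_assoc int_pow_neg)
        ultimately show "g \<in> generate G (insert l (K \<inter> L))"
          using subgroup.m_closed subgroup_int_pow_closed by metis
      qed
    qed
    then show ?thesis using polycyclic.extend[OF IH lc nl] by simp
  qed
qed

section \<open>From word counts to balls\<close>

lemma symmetric_generating_set_word:
  assumes S: "symmetric_generating_set G S" and g: "g \<in> carrier G"
  shows "\<exists>ws. set ws \<subseteq> S \<and> foldr (\<otimes>) ws \<one> = g"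
proof -
  have Sc: "S \<subseteq> carrier G" and sym: "\<And>s. s \<in> S \<Longrightarrow> inv s \<in> S" and gen: "generate G S = carrier G"
    using S unfolding symmetric_generating_set_def by auto
  have "g \<in> generate G S" using g gen by simp
  then show ?thesis
  proof (induction g rule: generate.induct)
    case one
    then show ?case by (intro exI[of _ "[]"]) simp
  next
    case (incl h)
    then show ?case using Sc by (intro exI[of _ "[h]"]) auto
  next
    case (inv h)
    then show ?case using Sc sym by (intro exI[of _ "[inv h]"]) auto
  next
    case (eng g h)
    then obtain us ws where "set us \<subseteq> S" "foldr (\<otimes>) us \<one> = g" "set ws \<subseteq> S" "foldr (\<otimes>) ws \<one> = h"
      by blast
    then show ?case
      using foldr_mult_append[of us ws] Sc by (intro exI[of _ "us @ ws"]) auto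
  qed
qed

text \<open>\<open>word_length\<close> is a \<open>LEAST\<close>, so it is attained only because
  some word for the element exists.\<close>

lemma word_ball_subset_word_products:
  assumes "symmetric_generating_set G S" shows "word_ball G R S \<subseteq> word_products G S R"
proof
  fix g assume g: "g \<in> word_ball G R S"
  then obtain ws where "set ws \<subseteq> S" "foldr (\<otimes>) ws \<one> = g"
    using symmetric_generating_set_word[OF assms] by (auto simp: word_ball_def)
  then have "\<exists>ws. set ws \<subseteq> S \<and> length ws = word_length G S g \<and> foldr (\<otimes>) ws \<one> = g"
    unfolding word_length_def
    by (intro LeastI_ex[where P = "\<lambda>n. \<exists>ws. set ws \<subseteq> S \<and> length ws = n \<and> foldr (\<otimes>) ws \<one> = g"]) blast
  then show "g \<in> word_products G S R"
    using g by (auto simp: word_ball_def word_products_def)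
qed

text \<open>If the letters of \<open>S'\<close> are words of length at most \<open>c\<close> over
  \<open>S\<close>, balls for \<open>S'\<close> lie in balls for \<open>S\<close> of
  \<open>c\<close> times the radius. The degree \<open>d\<close> comes from \<open>S\<close> alone;
  the constants depend on \<open>S'\<close> and are absorbed by the one extra factor in
  \<open>R ^ Suc d\<close>.\<close>

lemma polynomial_growth_if_poly_growth_on:
  assumes S: "finite S" "symmetric_generating_set G S" and growth: "poly_growth_on G (carrier G)"
  shows "polynomial_growth G"
proof -
  have Sc: "S \<subseteq> carrier G" using S unfolding symmetric_generating_set_def by auto
  obtain C d where C: "\<And>n. card (word_products G S n) \<le> C * Suc n ^ d"
    using growth S Sc unfolding poly_growth_on_def poly_bounded_def by blast
  have "\<exists>R\<^sub>0. \<forall>R\<ge>R\<^sub>0. card (word_ball G R S') \<le> R ^ Suc d"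
    if S': "finite S'" "symmetric_generating_set G S'" for S'
  proof -
    have S'c: "S' \<subseteq> carrier G" using S' unfolding symmetric_generating_set_def by auto
    have "\<forall>s\<in>S'. \<exists>n. s \<in> word_products G S n"
      using symmetric_generating_set_word[OF S(2)] S'c unfolding word_products_def by blast
    then obtain l where l: "\<And>s. s \<in> S' \<Longrightarrow> s \<in> word_products G S (l s)" by metis
    define c where "c = sum l S'"
    have "S' \<subseteq> word_products G S c"
      using l word_products_mono[of S S _ c] member_le_sum[of _ S' l] S'(1) unfolding c_def by blast
    then have sub: "word_ball G R S' \<subseteq> word_products G S (R * c)" for R
      using word_ball_subset_word_products[OF S'(2), of R] word_products_mono[of S' _ R R]
        word_products_word_products[OF Sc, of c R] by blast
    \<comment> \<open>The threshold lets one factor \<open>R\<close> dominate the constant; the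
      \<open>+ 1\<close> gives \<open>R \<ge> 1\<close>, needed for
      \<open>Suc (R * c) \<le> R * Suc c\<close>.\<close>
    have "card (word_ball G R S') \<le> R ^ Suc d" if R: "C * Suc c ^ d + 1 \<le> R" for R
    proof -
      have "card (word_ball G R S') \<le> card (word_products G S (R * c))"
        by (rule card_mono[OF finite_word_products[OF S(1)] sub])
      also have "\<dots> \<le> C * Suc (R * c) ^ d" by (rule C)
      also have "\<dots> \<le> C * (R * Suc c) ^ d"
        using R by (intro mult_le_mono2 power_mono) auto
      also have "\<dots> = (C * Suc c ^ d) * R ^ d" by (simp only: power_mult_distrib ac_simps)
      also have "\<dots> \<le> R * R ^ d" using R by (intro mult_le_mono1) auto
      finally show ?thesis by simp
    qed
    then show ?thesis by blast
  qed
  then show ?thesis unfolding polynomial_growth_def by blast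
qed

end

section \<open>Integer matrices with unimodular eigenvalues\<close>

lemma upper_triangular_mult:
  fixes A B :: "'a :: comm_ring_1 mat"
  assumes A: "A \<in> carrier_mat n n" "upper_triangular A" and B: "B \<in> carrier_mat n n" "upper_triangular B"
  shows "upper_triangular (A * B)"
    and "\<And>i. i < n \<Longrightarrow> (A * B) $$ (i, i) = A $$ (i, i) * B $$ (i, i)"
proof -
  have ent: "(A * B) $$ (i, j) = (\<Sum>k = 0..<n. A $$ (i, k) * B $$ (k, j))" if "i < n" "j < n" for i j
    using that A B by (auto simp: scalar_prod_def)
  have zero: "A $$ (i, k) * B $$ (k, j) = 0" if "i < n" "k < n" "k < i \<or> j < k" for i j k
    using that A B upper_triangularD[of A k i] upper_triangularD[of B j k] by auto
  show "upper_triangular (A * B)"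
  proof (rule upper_triangularI)
    fix i j assume ij: "j < i" "i < dim_row (A * B)"
    then have "(A * B) $$ (i, j) = (\<Sum>k = 0..<n. A $$ (i, k) * B $$ (k, j))" using A by (intro ent) auto
    also have "\<dots> = 0"
    proof (intro sum.neutral ballI zero)
      show "i < n" using ij A by simp
      show "k < i \<or> j < k" for k using ij(1) by linarith
    qed simp
    finally show "(A * B) $$ (i, j) = 0" .
  qed
  fix i assume i: "i < n"
  have "(A * B) $$ (i, i) = (\<Sum>k = 0..<n. A $$ (i, k) * B $$ (k, i))" using i by (rule ent) fact
  also have "\<dots> = (\<Sum>k\<in>{i}. A $$ (i, k) * B $$ (k, i))"
    using i zero[of i _ i] by (intro sum.mono_neutral_right) (auto, metis linorder_neqE_nat)
  finally show "(A * B) $$ (i, i) = A $$ (i, i) * B $$ (i, i)" by simp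
qed

lemma upper_triangular_pow:
  fixes B :: "'a :: comm_ring_1 mat"
  assumes B: "B \<in> carrier_mat n n" "upper_triangular B"
  shows "upper_triangular (B ^\<^sub>m k)" and "\<And>i. i < n \<Longrightarrow> (B ^\<^sub>m k) $$ (i, i) = B $$ (i, i) ^ k"
proof -
  have "upper_triangular (B ^\<^sub>m k) \<and> (\<forall>i<n. (B ^\<^sub>m k) $$ (i, i) = B $$ (i, i) ^ k)"
  proof (induction k)
    case (Suc k)
    have "B ^\<^sub>m k \<in> carrier_mat n n" using B by simp
    then show ?case using Suc upper_triangular_mult[of "B ^\<^sub>m k" n B] B by (simp add: mult.commute)
  qed (use B in auto)
  then show "upper_triangular (B ^\<^sub>m k)" and "\<And>i. i < n \<Longrightarrow> (B ^\<^sub>m k) $$ (i, i) = B $$ (i, i) ^ k"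
    by auto
qed

text \<open>The entries of the \<open>k\<close>-th power vanish for \<open>j < i + k\<close>: each
  factor pushes the support one diagonal further up.\<close>

lemma strictly_upper_triangular_nilpotent:
  fixes D :: "'a :: comm_ring_1 mat"
  assumes D: "D \<in> carrier_mat n n" and zero: "\<And>i j. i < n \<Longrightarrow> j \<le> i \<Longrightarrow> D $$ (i, j) = 0"
  shows "D ^\<^sub>m n = 0\<^sub>m n n"
proof -
  have "(D ^\<^sub>m k) $$ (i, j) = 0" if "i < n" "j < n" "j < i + k" for i j k
    using that
  proof (induction k arbitrary: i j)
    case 0
    then show ?case using D by auto
  next
    case (Suc k)
    have "(D ^\<^sub>m k) $$ (i, l) * D $$ (l, j) = 0" if "l < n" for l
      using Suc zero that by (cases "l < i + k") auto
    moreover have "(D ^\<^sub>m Suc k) $$ (i, j) = (\<Sum>l = 0..<n. (D ^\<^sub>m k) $$ (i, l) * D $$ (l, j))"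
      using Suc.prems D by (auto simp: scalar_prod_def)
    ultimately show ?case by simp
  qed
  then show ?thesis using D by (intro eq_matI) auto
qed

text \<open>Multiplication by \<open>X - a\<close> with \<open>|a| \<le> 1\<close> at most doubles a
  bound on the coefficients. The bound is crude, but depends on the number of factors only.\<close>

lemma cmod_coeff_linear_factors_le:
  assumes "\<And>a. a \<in> set as \<Longrightarrow> cmod a \<le> 1"
  shows "cmod (coeff (\<Prod>a\<leftarrow>as. [:- a, 1:]) i) \<le> 2 ^ length as"
  using assms
proof (induction as arbitrary: i)
  case Nil
  then show ?case by (simp add: coeff_1)
next
  case (Cons a as)
  let ?p = "\<Prod>a\<leftarrow>as. [:- a, 1:]"
  have IH: "cmod (coeff ?p j) \<le> 2 ^ length as" for j using Cons by auto
  have "coeff (\<Prod>a\<leftarrow>a # as. [:- a, 1:]) i = (case i of 0 \<Rightarrow> 0 | Suc j \<Rightarrow> coeff ?p j) - a * coeff ?p i"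
    by (simp add: coeff_pCons split: nat.splits)
  also have "cmod \<dots> \<le> cmod (case i of 0 \<Rightarrow> 0 | Suc j \<Rightarrow> coeff ?p j) + cmod (a * coeff ?p i)"
    by (rule norm_triangle_ineq4)
  also have "\<dots> \<le> 2 ^ length as + 1 * 2 ^ length as"
    using IH Cons.prems[of a] unfolding norm_mult
    by (intro add_mono mult_mono) (auto split: nat.splits)
  finally show ?case by simp
qed

lemma finite_bounded_int_polys:
  "finite {p :: int poly. degree p \<le> n \<and> (\<forall>i. \<bar>coeff p i\<bar> \<le> M)}" (is "finite ?P")
proof (rule finite_subset)
  show "?P \<subseteq> Poly ` {xs. set xs \<subseteq> {- M..M} \<and> length xs = Suc n}"
  proof
    fix p assume p: "p \<in> ?P"
    have "p = Poly (map (coeff p) [0..<Suc n])"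
      using p by (intro poly_eqI) (auto simp: coeff_Poly nth_default_def coeff_eq_0 simp del: upt_Suc)
    moreover have "- M \<le> coeff p i" "coeff p i \<le> M" for i using p by (auto simp: abs_le_iff minus_le_iff)
    ultimately show "p \<in> Poly ` {xs. set xs \<subseteq> {- M..M} \<and> length xs = Suc n}"
      by (intro image_eqI[of _ _ "map (coeff p) [0..<Suc n]"]) (auto simp del: upt_Suc)
  qed
qed (intro finite_imageI finite_lists_length_eq; simp)

text \<open>Kronecker's argument: the characteristic polynomials of all powers of \<open>A\<close> are integral with
  bounded coefficients, so every eigenvalue has finitely many powers and is a root of unity.\<close>

lemma unimodular_eigenvalues_imp_quasi_unipotent:
  fixes A :: "int mat"
  assumes A: "A \<in> carrier_mat n n"
    and ev: "\<And>c. eigenvalue (map_mat complex_of_int A) c \<Longrightarrow> cmod c = 1"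
  shows "\<exists>e>0. (A ^\<^sub>m e - 1\<^sub>m n) ^\<^sub>m n = 0\<^sub>m n n"
proof -
  define C where "C = map_mat complex_of_int A"
  have C: "C \<in> carrier_mat n n" using A by (simp add: C_def)
  obtain as where as: "char_poly C = (\<Prod>a\<leftarrow>as. [:- a, 1:])" "length as = n"
    using char_poly_factorized[OF C] by blast
  obtain B P Q where "schur_decomposition C as = (B, P, Q)" by (cases "schur_decomposition C as") auto
  then have wit: "similar_mat_wit C B P Q" and ut: "upper_triangular B" and diag: "diag_mat B = as"
    using schur_decomposition[OF C as(1)] by auto
  note w = similar_mat_witD2[OF C wit]
  have B: "B \<in> carrier_mat n n" and P: "P \<in> carrier_mat n n" and Q: "Q \<in> carrier_mat n n"
    and PQ: "P * Q = 1\<^sub>m n" using w by auto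
  have as_nth: "as ! i = B $$ (i, i)" if "i < n" for i using that B unfolding diag[symmetric] diag_mat_def by simp
  have root: "poly (\<Prod>a\<leftarrow>bs. [:- a, 1:]) b = 0" if "b \<in> set bs" for b :: complex and bs
    using that by (induction bs) auto
  have cmod: "cmod a = 1" if "a \<in> set as" for a
    using root[OF that] ev eigenvalue_root_char_poly[OF C] as(1) by (simp add: C_def)
  \<comment> \<open>Triangular form shows the \<open>k\<close>-th powers of the eigenvalues with
    multiplicity, on the diagonal of the \<open>k\<close>-th power of \<open>B\<close>.\<close>
  have cp: "char_poly (C ^\<^sub>m k) = (\<Prod>a\<leftarrow>map (\<lambda>a. a ^ k) as. [:- a, 1:])" for k
  proof -
    have "similar_mat (C ^\<^sub>m k) (B ^\<^sub>m k)"
      using similar_mat_wit_pow[OF wit] unfolding similar_mat_def by blast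
    then have "char_poly (C ^\<^sub>m k) = char_poly (B ^\<^sub>m k)" by (rule char_poly_similar)
    also have "\<dots> = (\<Prod>a\<leftarrow>diag_mat (B ^\<^sub>m k). [:- a, 1:])"
      using B by (intro char_poly_upper_triangular upper_triangular_pow[OF B ut]) auto
    also have "diag_mat (B ^\<^sub>m k) = map (\<lambda>a. a ^ k) as"
      using B upper_triangular_pow(2)[OF B ut, where k = k] as_nth as(2)
      by (intro nth_equalityI) (auto simp: diag_mat_def)
    finally show ?thesis .
  qed
  define \<P> where "\<P> = {p :: int poly. degree p \<le> n \<and> (\<forall>i. \<bar>coeff p i\<bar> \<le> 2 ^ n)}"
  have int_cp: "char_poly (C ^\<^sub>m k) = map_poly complex_of_int (char_poly (A ^\<^sub>m k))" for k
    unfolding C_def using A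
    by (simp add: of_int_hom.mat_hom_pow[symmetric] of_int_hom.char_poly_hom[of _ n])
  have inP: "char_poly (A ^\<^sub>m k) \<in> \<P>" for k
  proof -
    have "\<bar>coeff (char_poly (A ^\<^sub>m k)) i\<bar> \<le> 2 ^ n" for i
    proof -
      have "cmod (coeff (char_poly (C ^\<^sub>m k)) i) \<le> 2 ^ length (map (\<lambda>a. a ^ k) as)"
        unfolding cp by (rule cmod_coeff_linear_factors_le) (auto simp: norm_power cmod)
      then have "real_of_int \<bar>coeff (char_poly (A ^\<^sub>m k)) i\<bar> \<le> 2 ^ n"
        unfolding int_cp by (simp add: as(2))
      also have "\<dots> = real_of_int (2 ^ n)" by simp
      finally show ?thesis by (simp only: of_int_le_iff)
    qed
    moreover have "degree (char_poly (A ^\<^sub>m k)) = n"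
      using degree_monic_char_poly[of "A ^\<^sub>m k" n] A by simp
    ultimately show ?thesis by (simp add: \<P>_def)
  qed
  have root_of_unity: "\<exists>m>0. a ^ m = 1" if a: "a \<in> set as" for a
  proof -
    let ?R = "\<Union>p\<in>\<P> - {0}. {z. poly (map_poly complex_of_int p) z = 0}"
    have "finite ?R"
      unfolding \<P>_def by (intro finite_UN_I finite_Diff finite_bounded_int_polys poly_roots_finite) auto
    moreover have "range (\<lambda>k. a ^ k) \<subseteq> ?R"
    proof safe
      fix k
      have "poly (char_poly (C ^\<^sub>m k)) (a ^ k) = 0"
        unfolding cp by (rule root) (use a in auto)
      moreover have "char_poly (A ^\<^sub>m k) \<noteq> 0"
        using degree_monic_char_poly[of "A ^\<^sub>m k" n] A by auto
      ultimately show "a ^ k \<in> ?R" using inP[of k] unfolding int_cp by blast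
    qed
    ultimately have "\<not> inj (\<lambda>k. a ^ k)" using finite_subset finite_imageD infinite_UNIV_nat by metis
    then obtain j k where jk: "j < k" "a ^ j = a ^ k"
      unfolding inj_def by (metis linorder_neqE_nat)
    have "a \<noteq> 0" using cmod[OF a] by auto
    have "a ^ j * 1 = a ^ j * a ^ (k - j)" using jk by (metis le_add_diff_inverse less_imp_le mult_1_right power_add)
    then have "a ^ (k - j) = 1" using \<open>a \<noteq> 0\<close> by (metis mult_left_cancel power_not_zero)
    then show ?thesis using jk(1) by (intro exI[of _ "k - j"]) simp
  qed
  then obtain m where m: "\<And>a. a \<in> set as \<Longrightarrow> 0 < m a" "\<And>a. a \<in> set as \<Longrightarrow> a ^ m a = 1" by metis
  \<comment> \<open>A common multiple of the orders of all eigenvalues; the empty product gives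
    \<open>1\<close> when \<open>n = 0\<close>.\<close>
  define e where "e = prod m (set as)"
  have "e > 0" unfolding e_def using m by (simp add: prod_pos)
  have ae: "a ^ e = 1" if "a \<in> set as" for a
  proof -
    have "m a dvd e" unfolding e_def using that by (simp add: dvd_prodI)
    then show ?thesis using m(2)[OF that] by (auto simp: power_mult elim!: dvdE)
  qed
  \<comment> \<open>The \<open>e\<close>-th power of \<open>B\<close> is triangular with only ones
    on the diagonal, so \<open>D\<close> is strictly upper triangular.\<close>
  define D where "D = B ^\<^sub>m e - 1\<^sub>m n"
  have D: "D \<in> carrier_mat n n" unfolding D_def by (rule minus_carrier_mat) simp
  have Be: "B ^\<^sub>m e \<in> carrier_mat n n" using B by simp
  have "D $$ (i, j) = 0" if "i < n" "j \<le> i" for i j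
  proof (cases "j = i")
    case True
    then show ?thesis using that B ae as_nth as(2) upper_triangular_pow(2)[OF B ut, where k = e and i = i]
      by (simp add: D_def) (metis nth_mem)
  next
    case False
    then have "(B ^\<^sub>m e) $$ (i, j) = 0"
      using that B upper_triangularD[OF upper_triangular_pow(1)[OF B ut, where k = e], of j i] by simp
    then show ?thesis using that False B by (simp add: D_def)
  qed
  then have Dn: "D ^\<^sub>m n = 0\<^sub>m n n" using D by (intro strictly_upper_triangular_nilpotent)
  have "C ^\<^sub>m e - 1\<^sub>m n = P * D * Q"
  proof -
    have "P * D * Q = P * B ^\<^sub>m e * Q - P * 1\<^sub>m n * Q"
      unfolding D_def using P Q Be
      by (simp add: mult_minus_distrib_mat[of _ n n] minus_mult_distrib_mat[of _ n n])
    then show ?thesis using similar_mat_wit_pow_id[OF wit, of e] P PQ by simp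
  qed
  moreover have "similar_mat_wit (P * D * Q) D P Q"
    using P Q D w by (intro similar_mat_witI[of _ _ n]) auto
  ultimately have "(C ^\<^sub>m e - 1\<^sub>m n) ^\<^sub>m n = P * D ^\<^sub>m n * Q"
    using similar_mat_wit_pow_id by metis
  also have "\<dots> = 0\<^sub>m n n" using P Q Dn by simp
  \<comment> \<open>Back to the integers: both sides are images of integer matrices under an
    injective homomorphism.\<close>
  also have "C ^\<^sub>m e - 1\<^sub>m n = map_mat complex_of_int (A ^\<^sub>m e - 1\<^sub>m n)"
    using A unfolding C_def by (intro eq_matI) (auto simp: of_int_hom.mat_hom_pow[symmetric])
  finally have "map_mat complex_of_int ((A ^\<^sub>m e - 1\<^sub>m n) ^\<^sub>m n) = map_mat complex_of_int (0\<^sub>m n n)"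
    using A by (subst of_int_hom.mat_hom_pow[of _ n]) auto
  then have "(A ^\<^sub>m e - 1\<^sub>m n) ^\<^sub>m n = 0\<^sub>m n n" by (rule of_int_hom.mat_hom_inj)
  with \<open>e > 0\<close> show ?thesis by blast
qed

section \<open>The action on a free abelian section\<close>

definition coordinates ::
  "nat \<Rightarrow> ((nat \<Rightarrow>\<^sub>0 int) \<Rightarrow> 'a) \<Rightarrow> 'a \<Rightarrow> int vec" where
  "coordinates m f y =
     vec m (Poly_Mapping.lookup (inv_into (carrier (free_Abelian_group {..<m})) f y))"

text \<open>An additive function is determined by its values on the basis. Additivity is required on
  vectors supported below \<open>m\<close>, which is where \<open>f\<close> is a
  homomorphism.\<close>

lemma additive_eq_sum_basis:
  fixes ell :: "(nat \<Rightarrow>\<^sub>0 int) \<Rightarrow> int"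
  assumes v: "Poly_Mapping.keys v \<subseteq> {..<m}"
    and add: "\<And>x y. \<lbrakk>Poly_Mapping.keys x \<subseteq> {..<m}; Poly_Mapping.keys y \<subseteq> {..<m}\<rbrakk> \<Longrightarrow> ell (x + y) = ell x + ell y"
  shows "ell v = (\<Sum>j<m. ell (frag_of j) * Poly_Mapping.lookup v j)"
  using v
proof (induction v rule: free_Abelian_group_induct[consumes 1, case_names zero diff basis])
  case zero
  then show ?case using add[of 0 0] by simp
next
  case (diff x y)
  have "Poly_Mapping.keys (x - y) \<subseteq> {..<m}" using diff keys_diff[of x y] by auto
  then have "ell x = ell (x - y) + ell y" using add[of "x - y" y] diff by simp
  then show ?case using diff by (simp add: lookup_minus right_diff_distrib sum_subtractf)
next
  case (basis j)
  have "(\<Sum>i<m. ell (frag_of i) * Poly_Mapping.lookup (frag_of j) i) = (\<Sum>i\<in>{j}. ell (frag_of i) * Poly_Mapping.lookup (frag_of j) i)"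
    using basis by (intro sum.mono_neutral_right) auto
  then show ?case by simp
qed

context
  fixes M :: "('a, 'b) monoid_scheme" and m :: nat and f
  assumes M: "group M" and f: "f \<in> iso (free_Abelian_group {..<m}) M"
begin

lemma coordinates_carrier [simp]: "coordinates m f y \<in> carrier_vec m"
  by (simp add: coordinates_def)

lemma iso_inverse: "inv_into (carrier (free_Abelian_group {..<m})) f \<in> iso M (free_Abelian_group {..<m})"
  using group.iso_set_sym[OF group_free_Abelian_group f] .

lemma iso_inverse_cancel:
  "y \<in> carrier M \<Longrightarrow> f (inv_into (carrier (free_Abelian_group {..<m})) f y) = y"
  using f by (intro f_inv_into_f) (auto simp: iso_def bij_betw_def)

lemma iso_inverse_keys:
  "y \<in> carrier M \<Longrightarrow> Poly_Mapping.keys (inv_into (carrier (free_Abelian_group {..<m})) f y) \<subseteq> {..<m}"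
  using hom_in_carrier[OF iso_imp_homomorphism[OF iso_inverse]] by (simp only: carrier_free_Abelian_group_iff)

lemma coordinates_mult:
  "y \<in> carrier M \<Longrightarrow> z \<in> carrier M
    \<Longrightarrow> coordinates m f (y \<otimes>\<^bsub>M\<^esub> z) = coordinates m f y + coordinates m f z"
  unfolding coordinates_def
  using hom_mult[OF iso_imp_homomorphism[OF iso_inverse], of y z]
  by (intro eq_vecI) (simp_all add: lookup_add)

lemma coordinates_eq_zero:
  assumes y: "y \<in> carrier M" and zero: "coordinates m f y = 0\<^sub>v m"
  shows "y = \<one>\<^bsub>M\<^esub>"
proof -
  let ?v = "inv_into (carrier (free_Abelian_group {..<m})) f y"
  have "Poly_Mapping.lookup ?v i = 0" for i
  proof (cases "i < m")
    case True
    then show ?thesis using arg_cong[OF zero, of "\<lambda>v. v $ i"] by (simp add: coordinates_def)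
  next
    case False
    then show ?thesis using iso_inverse_keys[OF y] by (auto simp: in_keys_iff)
  qed
  then have "?v = 0" by (intro poly_mapping_eqI) simp
  then have "y = f 0" using iso_inverse_cancel[OF y] by simp
  also have "f 0 = \<one>\<^bsub>M\<^esub>"
    using hom_one[OF iso_imp_homomorphism[OF f] group_free_Abelian_group M] by simp
  finally show ?thesis .
qed

text \<open>For fixed \<open>i\<close>, the \<open>i\<close>-th coordinate of
  \<open>\<phi> (f v)\<close> is additive in \<open>v\<close>, and its values on the basis form the
  \<open>i\<close>-th row of the matrix.\<close>

lemma coordinates_endo:
  assumes \<phi>: "\<phi> \<in> hom M M" and y: "y \<in> carrier M"
  shows "coordinates m f (\<phi> y) = endo_matrix M m f \<phi> *\<^sub>v coordinates m f y"
proof (rule eq_vecI)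
  let ?g = "inv_into (carrier (free_Abelian_group {..<m})) f"
  have fh: "f \<in> hom (free_Abelian_group {..<m}) M" using f by (rule iso_imp_homomorphism)
  note gh = iso_imp_homomorphism[OF iso_inverse]
  fix i assume "i < dim_vec (endo_matrix M m f \<phi> *\<^sub>v coordinates m f y)"
  then have i: "i < m" by (simp add: endo_matrix_def)
  define ell where "ell = (\<lambda>v. Poly_Mapping.lookup (?g (\<phi> (f v))) i)"
  have add: "ell (u + v) = ell u + ell v"
    if "Poly_Mapping.keys u \<subseteq> {..<m}" "Poly_Mapping.keys v \<subseteq> {..<m}" for u v
  proof -
    have c: "f u \<in> carrier M" "f v \<in> carrier M" using that hom_in_carrier[OF fh] by simp_all
    have "f (u + v) = f u \<otimes>\<^bsub>M\<^esub> f v" using hom_mult[OF fh, of u v] that by simp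
    then have "?g (\<phi> (f (u + v))) = ?g (\<phi> (f u)) + ?g (\<phi> (f v))"
      using c hom_mult[OF \<phi>] hom_mult[OF gh, of "\<phi> (f u)" "\<phi> (f v)"] hom_in_carrier[OF \<phi>] by simp
    then show ?thesis by (simp add: ell_def lookup_add)
  qed
  have "coordinates m f (\<phi> y) $ i = ell (?g y)"
    using i iso_inverse_cancel[OF y] by (simp add: coordinates_def ell_def)
  also have "\<dots> = (\<Sum>j<m. ell (frag_of j) * Poly_Mapping.lookup (?g y) j)"
    using iso_inverse_keys[OF y] add by (rule additive_eq_sum_basis)
  also have "\<dots> = (endo_matrix M m f \<phi> *\<^sub>v coordinates m f y) $ i"
    using i by (simp add: endo_matrix_def coordinates_def scalar_prod_def ell_def lessThan_atLeast0)
  finally show "coordinates m f (\<phi> y) $ i = (endo_matrix M m f \<phi> *\<^sub>v coordinates m f y) $ i" .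
qed (simp add: coordinates_def endo_matrix_def)

text \<open>In coordinates the map taking \<open>y\<close> to \<open>\<phi>^e(y) y^-1\<close> is
  multiplication by \<open>A^e - 1\<close>, for \<open>A\<close> the matrix of
  \<open>\<phi>\<close>.\<close>

lemma quasi_unipotent_iterate:
  assumes \<phi>: "\<phi> \<in> hom M M" and y: "y \<in> carrier M"
    and nil: "(endo_matrix M m f \<phi> ^\<^sub>m e - 1\<^sub>m m) ^\<^sub>m m = 0\<^sub>m m m"
  shows "((\<lambda>y. (\<phi> ^^ e) y \<otimes>\<^bsub>M\<^esub> inv\<^bsub>M\<^esub> y) ^^ m) y = \<one>\<^bsub>M\<^esub>"
proof -
  interpret M: group M by (rule M)
  let ?A = "endo_matrix M m f \<phi>" and ?D = "\<lambda>y. (\<phi> ^^ e) y \<otimes>\<^bsub>M\<^esub> inv\<^bsub>M\<^esub> y"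
  have A: "?A \<in> carrier_mat m m" by (simp add: endo_matrix_def)
  have \<phi>c: "(\<phi> ^^ k) z \<in> carrier M" if "z \<in> carrier M" for k z
    using that hom_in_carrier[OF \<phi>] by (induction k) auto
  have pow: "coordinates m f ((\<phi> ^^ k) z) = ?A ^\<^sub>m k *\<^sub>v coordinates m f z" if "z \<in> carrier M" for k z
    using that
  proof (induction k arbitrary: z)
    case 0
    then show ?case using A by simp
  next
    case (Suc k)
    have "(\<phi> ^^ Suc k) z = (\<phi> ^^ k) (\<phi> z)" by (simp add: funpow_Suc_right del: funpow.simps)
    then show ?case
      using Suc A hom_in_carrier[OF \<phi>] coordinates_endo[OF \<phi>]
      by (simp add: assoc_mult_mat_vec[of _ m m _ m])
  qed
  have D: "coordinates m f (?D z) = (?A ^\<^sub>m e - 1\<^sub>m m) *\<^sub>v coordinates m f z" if z: "z \<in> carrier M" for z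
  proof -
    \<comment> \<open>Multiplying back by \<open>z\<close> avoids coordinates of an inverse.\<close>
    have "?D z \<otimes>\<^bsub>M\<^esub> z = (\<phi> ^^ e) z" using z \<phi>c by (simp add: M.m_assoc)
    then have "coordinates m f ((\<phi> ^^ e) z) = coordinates m f (?D z) + coordinates m f z"
      using coordinates_mult[of "?D z" z] z \<phi>c by simp
    then have "coordinates m f (?D z) = coordinates m f ((\<phi> ^^ e) z) - coordinates m f z"
      by (intro eq_vecI) (auto simp: coordinates_def)
    also have "\<dots> = (?A ^\<^sub>m e - 1\<^sub>m m) *\<^sub>v coordinates m f z"
      using pow[OF z] A by (subst minus_mult_distrib_mat_vec[of _ m m]) auto
    finally show ?thesis .
  qed
  have Dc: "(?D ^^ k) z \<in> carrier M" if "z \<in> carrier M" for k z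
    using that \<phi>c by (induction k) auto
  let ?E = "?A ^\<^sub>m e - 1\<^sub>m m"
  have E: "?E \<in> carrier_mat m m" by (rule minus_carrier_mat) simp
  have "coordinates m f ((?D ^^ k) z) = ?E ^\<^sub>m k *\<^sub>v coordinates m f z" if "z \<in> carrier M" for k z
    using that
  proof (induction k arbitrary: z)
    case 0
    then show ?case using E by simp
  next
    case (Suc k)
    have "(?D ^^ Suc k) z = (?D ^^ k) (?D z)" by (simp only: funpow_Suc_right comp_apply)
    then show ?case
      using Suc.IH[of "?D z"] Suc.prems Dc[of z 1] D[of z] E
      by (simp add: assoc_mult_mat_vec[of _ m m _ m])
  qed
  from this[OF y, of m] have "coordinates m f ((?D ^^ m) y) = 0\<^sub>m m m *\<^sub>v coordinates m f y"
    by (simp only: nil)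
  also have "\<dots> = 0\<^sub>v m" by (intro eq_vecI) (auto simp: scalar_prod_def coordinates_def)
  finally show ?thesis by (rule coordinates_eq_zero[OF Dc[OF y]])
qed

end

text \<open>Finitely many generators involve finitely many basis elements, and sums and negatives
  involve no others.\<close>

lemma finite_basis_free_Abelian_group:
  assumes F: "finite F" and gen: "generate (free_Abelian_group B) F = carrier (free_Abelian_group B)"
  shows "finite B"
proof -
  define U where "U = (\<Union>x\<in>F. Poly_Mapping.keys x)"
  have "Poly_Mapping.keys x \<subseteq> U" if "x \<in> generate (free_Abelian_group B) F" for x
    using that
  proof (induction x rule: generate.induct)
    case (inv h)
    then have "Poly_Mapping.keys h \<subseteq> B" using gen by (metis carrier_free_Abelian_group_iff generate.incl)
    then show ?case using inv by (auto simp: U_def)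
  next
    case (eng g h)
    then show ?case using keys_add[of g h] by auto
  qed (auto simp: U_def)
  then have "Poly_Mapping.keys (frag_of b) \<subseteq> U" if "b \<in> B" for b
    using gen that frag_of_in_free_Abelian_group[of b B] by blast
  then have "B \<subseteq> U" by auto
  moreover have "finite U" unfolding U_def using F by simp
  ultimately show ?thesis by (rule finite_subset)
qed

text \<open>\<open>free_abelian\<close> yields a basis of unknown size, while
  \<open>endo_matrix\<close> wants one indexed by \<open>{..<m}\<close>; finite generation allows
  the reindexing.\<close>

lemma free_abelian_finite_rank:
  fixes M :: "('a, 'b) monoid_scheme"
  assumes M: "group M" and free: "free_abelian M" and F: "finite F" "F \<subseteq> carrier M" "generate M F = carrier M"
  shows "\<exists>m f. f \<in> iso (free_Abelian_group {..<m::nat}) M"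
proof -
  obtain B :: "'a set" where B: "M \<cong> free_Abelian_group B"
    using free unfolding free_abelian_def by blast
  then obtain h where h: "h \<in> iso M (free_Abelian_group B)" unfolding is_iso_def by blast
  have "group_hom M (free_Abelian_group B) h"
    using M iso_imp_homomorphism[OF h] by (simp add: group_hom_def group_hom_axioms_def)
  then have "generate (free_Abelian_group B) (h ` F) = h ` carrier M"
    using group_hom.generate_img F by metis
  also have "\<dots> = carrier (free_Abelian_group B)" using h by (auto simp: iso_def bij_betw_def)
  finally have "finite B" using finite_basis_free_Abelian_group F(1) by blast
  then have "free_Abelian_group {..<card B} \<cong> free_Abelian_group B"
    unfolding isomorphic_free_Abelian_groups by (simp add: eqpoll_iff_card)
  then have "free_Abelian_group {..<card B} \<cong> M"
    using group.iso_sym[OF M B] iso_trans by blast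
  then show ?thesis unfolding is_iso_def by blast
qed

context
  fixes G :: "('a, 'b) monoid_scheme" (structure) and N H K :: "'a set"
  assumes G: "group G" and N: "N \<lhd> G" and H: "H \<lhd> G" and K: "K \<lhd> G"
    and KH: "K \<subseteq> H" and comm: "commutator_subgroup G N H \<subseteq> K"
begin

lemma section_group_is_group: "group (section_group G H K)"
proof -
  have "subgroup H G" using H by (rule normal_imp_subgroup)
  then show ?thesis
    using group.normal_restrict_supergroup[OF G _ K KH] normal.factorgroup_is_group by blast
qed

lemma section_group_hom: "(\<lambda>x. K #> x) \<in> hom (G\<lparr>carrier := H\<rparr>) (section_group G H K)"
proof -
  have "subgroup H G" using H by (rule normal_imp_subgroup)
  then have "normal K (G\<lparr>carrier := H\<rparr>)" using group.normal_restrict_supergroup[OF G _ K KH] by blast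
  from normal.r_coset_hom_Mod[OF this] show ?thesis by (simp add: r_coset_def)
qed

lemma section_group_finitely_generated:
  assumes F: "finite F" "generate G F = H"
  shows "generate (section_group G H K) ((\<lambda>x. K #> x) ` F) = carrier (section_group G H K)"
proof -
  interpret group G by (rule G)
  have sH: "subgroup H G" using H by (rule normal_imp_subgroup)
  have FH: "F \<subseteq> H" using F(2) by (auto intro: generate.incl)
  have "group_hom (G\<lparr>carrier := H\<rparr>) (section_group G H K) (\<lambda>x. K #> x)"
    using section_group_hom section_group_is_group subgroup.subgroup_is_group[OF sH G]
    by (simp add: group_hom_def group_hom_axioms_def)
  then have "generate (section_group G H K) ((\<lambda>x. K #> x) ` F) = (\<lambda>x. K #> x) ` generate (G\<lparr>carrier := H\<rparr>) F"
    using group_hom.generate_img FH by fastforce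
  also have "\<dots> = carrier (section_group G H K)"
    using generate_consistent[OF FH sH] F(2) carrier_section_group[OF G N H K KH comm] by simp
  finally show ?thesis .
qed

text \<open>Commutation with \<open>\<gamma>^e\<close> induces on the section the map taking
  \<open>C\<close> to \<open>\<phi>^e(C) C^-1\<close>, where \<open>\<phi>\<close> is the action of
  \<open>\<gamma>\<close>. For a suitable \<open>e\<close> its matrix is nilpotent, so
  \<open>m\<close> commutations lead into \<open>K\<close>, with \<open>e\<close> and
  \<open>m\<close> independent of \<open>x\<close>.\<close>

lemma iterated_commutator_in_section:
  assumes F: "finite F" "generate G F = H" and free: "free_abelian (section_group G H K)"
    and \<gamma>: "\<gamma> \<in> carrier G"
    and ev: "\<And>c. endo_eigenvalue (section_group G H K) (conj_action G H K (N #> \<gamma>)) c \<Longrightarrow> cmod c = 1"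
  shows "\<exists>e>0. \<exists>m. \<forall>x\<in>H. (commutator G (\<gamma> [^] (e::nat)) ^^ m) x \<in> K"
proof -
  interpret group G by (rule G)
  let ?M = "section_group G H K" and ?\<phi> = "conj_action G H K (N #> \<gamma>)"
  have sH: "subgroup H G" and sK: "subgroup K G" using H K by (simp_all add: normal_imp_subgroup)
  have Hc: "H \<subseteq> carrier G" using sH by (rule subgroup.subset)
  note M = section_group_is_group and carr = carrier_section_group[OF G N H K KH comm]
  interpret M: group ?M by (rule M)
  have FH: "F \<subseteq> H" using F(2) by (auto intro: generate.incl)
  obtain m f where f: "f \<in> iso (free_Abelian_group {..<m::nat}) ?M"
    using free_abelian_finite_rank[OF M free finite_imageI[OF F(1)] _ section_group_finitely_generated[OF F]]
      FH carr by (metis image_mono)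
  have "N #> \<gamma> \<in> carrier (G Mod N)" using \<gamma> by (auto simp: carrier_FactGroup)
  then have "?\<phi> \<in> carrier (AutoGroup ?M)"
    using hom_in_carrier[OF conj_action_hom[OF G N H K KH comm]] by blast
  then have \<phi>: "?\<phi> \<in> hom ?M ?M" by (simp add: AutoGroup_def auto_def)
  have "\<exists>e>0. (endo_matrix ?M m f ?\<phi> ^\<^sub>m e - 1\<^sub>m m) ^\<^sub>m m = 0\<^sub>m m m"
  proof (rule unimodular_eigenvalues_imp_quasi_unipotent)
    \<comment> \<open>\<open>endo_eigenvalue\<close> allows any basis, so the chosen
      \<open>m\<close> and \<open>f\<close> are witnesses.\<close>
    fix c assume "eigenvalue (map_mat complex_of_int (endo_matrix ?M m f ?\<phi>)) c"
    then show "cmod c = 1" using f by (intro ev) (auto simp: endo_eigenvalue_def)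
  qed (simp add: endo_matrix_def)
  then obtain e where e: "e > 0" "(endo_matrix ?M m f ?\<phi> ^\<^sub>m e - 1\<^sub>m m) ^\<^sub>m m = 0\<^sub>m m m" by blast
  have conjH: "conj_by G g x \<in> H" if "g \<in> carrier G" "x \<in> H" for g x
    using normal.inv_op_closed2[OF H that] by (simp add: conj_by_def)
  have pow: "(?\<phi> ^^ k) (K #> x) = K #> conj_by G (\<gamma> [^] k) x" if "x \<in> H" for k x
  proof (induction k)
    case 0
    then show ?case using that Hc by (auto simp: subset_iff)
  next
    case (Suc k)
    have "(?\<phi> ^^ Suc k) (K #> x) = K #> conj_by G \<gamma> (conj_by G (\<gamma> [^] k) x)"
      using Suc conj_action_coset[OF G N H K KH comm \<gamma> conjH[OF _ that, of "\<gamma> [^] k"]] \<gamma>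
      by (simp add: conj_by_def)
    also have "conj_by G \<gamma> (conj_by G (\<gamma> [^] k) x) = conj_by G (\<gamma> [^] Suc k) x"
      using \<gamma> that Hc nat_pow_Suc2[OF \<gamma>, of k] by (subst conj_by_conj_by) (auto simp del: nat_pow_Suc)
    finally show ?case .
  qed
  let ?D = "\<lambda>y. (?\<phi> ^^ e) y \<otimes>\<^bsub>?M\<^esub> inv\<^bsub>?M\<^esub> y"
  let ?d = "commutator G (\<gamma> [^] e)"
  have dH: "?d x \<in> H" if "x \<in> H" for x
    using conjH[of "\<gamma> [^] e" x] that \<gamma> sH
    by (simp add: commutator_def conj_by_def subgroup.m_closed subgroup.m_inv_closed)
  have D: "?D (K #> x) = K #> ?d x" if x: "x \<in> H" for x
  proof -
    have d: "?d x \<in> H" by (rule dH[OF x])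
    have c: "K #> ?d x \<in> carrier ?M" "K #> x \<in> carrier ?M" using carr d x by auto
    have "conj_by G (\<gamma> [^] e) x = ?d x \<otimes> x"
      using x Hc \<gamma> by (intro conj_by_eq_commutator) auto
    then have "(?\<phi> ^^ e) (K #> x) = (K #> ?d x) \<otimes>\<^bsub>?M\<^esub> (K #> x)"
      using pow[OF x, of e] hom_mult[OF section_group_hom, of "?d x" x] d x by simp
    then show ?thesis
      by (simp only: M.m_assoc[OF c M.inv_closed[OF c(2)]] M.r_inv[OF c(2)] M.r_one[OF c(1)])
  qed
  define \<D> where "\<D> = ?D"
  have DD: "(\<D> ^^ k) (K #> x) = K #> (?d ^^ k) x \<and> (?d ^^ k) x \<in> H" if "x \<in> H" for k x
  proof (induction k)
    case (Suc k)
    then have "\<D> ((\<D> ^^ k) (K #> x)) = K #> ?d ((?d ^^ k) x)"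
      using D by (simp add: \<D>_def)
    then show ?case using Suc dH by simp
  qed (use that in simp)
  have "(?d ^^ m) x \<in> K" if x: "x \<in> H" for x
  proof -
    have "(\<D> ^^ m) (K #> x) = \<one>\<^bsub>?M\<^esub>"
      unfolding \<D>_def using carr x by (intro quasi_unipotent_iterate[OF M f \<phi> _ e(2)]) auto
    then have "K #> (?d ^^ m) x = K" using DD[OF x, of m] by (simp add: FactGroup_def)
    moreover have "(?d ^^ m) x \<in> carrier G" using DD[OF x, of m] Hc by auto
    ultimately show ?thesis using rcos_self[OF _ sK] by metis
  qed
  then show ?thesis using e(1) by blast
qed

end

section \<open>Extensions by virtually nilpotent groups\<close>

text \<open>Each stage of the construction keeps the earlier letters, so the final set contains a
  generating set of every term down to a trivial one. The extension argument uses graded sets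
  through this property.\<close>

lemma graded_gens_levels:
  assumes G: "group G" and H: "subgroup H G" and T: "graded_gens G H i T"
  shows "finite T \<and> T \<subseteq> lower_central G H i \<and> generate G T = lower_central G H i \<and>
    (\<exists>s>i. lower_central G H s = {\<one>\<^bsub>G\<^esub>} \<and>
      (\<forall>j. i \<le> j \<and> j < s \<longrightarrow> (\<exists>A\<subseteq>T. finite A \<and> A \<subseteq> lower_central G H j \<and> generate G A = lower_central G H j)))"
  using T
proof (induction rule: graded_gens.induct)
  case (start i T)
  then show ?case by (auto intro!: exI[of _ "Suc i"] exI[of _ T] simp: le_less_Suc_eq)
next
  case (extend i T A)
  obtain s where s: "s > Suc i" "lower_central G H s = {\<one>\<^bsub>G\<^esub>}"
    "\<And>j. Suc i \<le> j \<Longrightarrow> j < s \<Longrightarrow> \<exists>A\<subseteq>T. finite A \<and> A \<subseteq> lower_central G H j \<and> generate G A = lower_central G H j"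
    using extend.IH by blast
  have sub: "T \<union> A \<subseteq> lower_central G H i"
    using extend.IH extend.hyps(3) group.lower_central_Suc_subset[OF G H, of i] by blast
  have fin: "finite (T \<union> A)" using extend by blast
  have "\<exists>B\<subseteq>T \<union> A. finite B \<and> B \<subseteq> lower_central G H j \<and> generate G B = lower_central G H j"
    if "i \<le> j" "j < s" for j
  proof (cases "j = i")
    case True
    then show ?thesis using sub fin extend.hyps(4) by blast
  next
    case False
    then have "Suc i \<le> j" using that by simp
    from s(3)[OF this that(2)] show ?thesis by blast
  qed
  moreover have "i < s" using s(1) by simp
  ultimately show ?case using s(2) sub fin extend.hyps(4) by (intro conjI exI[of _ s] allI impI) auto
qed

lemma (in group_hom) hom_commutator:
  "x \<in> carrier G \<Longrightarrow> y \<in> carrier G \<Longrightarrow> h (commutator G x y) = commutator H (h x) (h y)"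
  by (simp add: commutator_def)

lemma (in group_hom) subgroup_preimage:
  assumes "subgroup L H" shows "subgroup {x \<in> carrier G. h x \<in> L} G"
  using assms by (intro G.subgroupI)
    (auto simp: subgroup.one_closed subgroup.m_closed subgroup.m_inv_closed intro!: exI[of _ "\<one>"])

context group
begin

lemma normalises_pow:
  assumes "normalises G t K" "t \<in> carrier G" "K \<subseteq> carrier G"
  shows "normalises G (t [^] (e::nat)) K"
proof -
  have "inv (t [^] e) = t [^] (- int e)" using assms(2) by (simp add: int_pow_neg_int)
  then show ?thesis
    using conj_by_int_pow_closed[OF assms, of _ "int e"] conj_by_int_pow_closed[OF assms, of _ "- int e"]
    by (simp add: normalises_def int_pow_int)
qed

lemma poly_conjugated_pow':
  assumes t: "t \<in> carrier G" and x: "poly_conjugated G K t x"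
  shows "poly_conjugated G K (t [^] (e::nat)) x"
proof -
  obtain F C d where F: "finite F" "F \<subseteq> K" and
    *: "\<And>a::int. conj_by G (t [^] a) x \<in> word_products G F (C * Suc (nat \<bar>a\<bar>) ^ d)"
    using x unfolding poly_conjugated_def by blast
  show ?thesis
  proof (rule poly_conjugatedI[OF F])
    fix a :: int
    have "(t [^] e) [^] a = t [^] (int e * a)"
      using t int_pow_pow[of t "int e" a] by (simp add: int_pow_int)
    then show "conj_by G ((t [^] e) [^] a) x \<in> word_products G F (C * Suc (e * nat \<bar>a\<bar>) ^ d)"
      using *[of "int e * a"] by (simp add: abs_mult nat_mult_distrib)
  qed (intro poly_bounded_intros)
qed

text \<open>The exponent \<open>e\<close> varies with \<open>h\<close>, while the induction is about
  \<open>t\<close>. Each step therefore passes from \<open>t\<close> to \<open>t^e\<close>, goes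
  back along commutators with \<open>t^e\<close> from \<open>Ns (h + 1)\<close> to
  \<open>Ns h\<close>, and returns to \<open>t\<close>.\<close>

lemma poly_conjugated_filtration:
  fixes Ns :: "nat \<Rightarrow> 'a set"
  assumes K: "subgroup K G" and t: "t \<in> carrier G" "normalises G t K"
    and NK: "\<And>h. 1 \<le> h \<Longrightarrow> h \<le> k + 1 \<Longrightarrow> Ns h \<subseteq> K"
    and base: "\<And>x. x \<in> Ns (k + 1) \<Longrightarrow> poly_conjugated G K t x"
    and act: "\<And>h. 1 \<le> h \<Longrightarrow> h \<le> k \<Longrightarrow>
      \<exists>e>0. \<exists>m. \<forall>x\<in>Ns h. (commutator G (t [^] (e::nat)) ^^ m) x \<in> Ns (h + 1)"
    and x: "x \<in> Ns 1"
  shows "poly_conjugated G K t x"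
proof -
  have "\<forall>x\<in>Ns 1. poly_conjugated G K t x"
  proof (rule inc_induct[of 1 "k + 1" "\<lambda>h. \<forall>x\<in>Ns h. poly_conjugated G K t x"])
    fix h assume h: "1 \<le> h" "h < k + 1" and IH: "\<forall>x\<in>Ns (Suc h). poly_conjugated G K t x"
    obtain e m where e: "0 < e" "\<And>x. x \<in> Ns h \<Longrightarrow> (commutator G (t [^] (e::nat)) ^^ m) x \<in> Ns (Suc h)"
      using act[of h] h by auto
    show "\<forall>x\<in>Ns h. poly_conjugated G K t x"
    proof
      fix x assume x: "x \<in> Ns h"
      have xK: "x \<in> K" using x NK[of h] h by auto
      have "poly_conjugated G K (t [^] e) ((commutator G (t [^] e) ^^ m) x)"
        using IH e(2)[OF x] t by (intro poly_conjugated_pow') auto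
      then have "poly_conjugated G K (t [^] e) x"
        using K t xK subgroup.subset[OF K]
        by (intro poly_conjugated_iterated_commutator[of K "t [^] e" x m] normalises_pow) auto
      then show "poly_conjugated G K t x"
        by (rule poly_conjugated_pow[OF K t xK e(1)])
    qed
  qed (use base in auto)
  then show ?thesis using x by blast
qed

text \<open>The preimages \<open>M i\<close> of the lower central series of \<open>H\<close> descend
  to \<open>N\<close> and are central relative to \<open>M 0\<close>, so
  \<open>central_series_induct\<close> applies. \<open>act\<close> ranges over all intermediate
  \<open>K\<close> because the letters of a conjugate need only lie in the current
  \<open>K\<close>.\<close>

lemma poly_growth_on_virtually_nilpotent_extension:
  assumes N: "N \<lhd> G" and growth: "poly_growth_on G N"
    and H: "subgroup H (G Mod N)" "finite_index (G Mod N) H"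
    and T: "graded_gens (G Mod N) H 0 T" "T \<subseteq> (\<lambda>\<gamma>. N #> \<gamma>) ` S\<^sub>0" and S\<^sub>0: "S\<^sub>0 \<subseteq> carrier G"
    and act: "\<And>K t x. \<lbrakk>subgroup K G; N \<subseteq> K; t \<in> S\<^sub>0; normalises G t K; x \<in> N\<rbrakk> \<Longrightarrow> poly_conjugated G K t x"
  shows "poly_growth_on G (carrier G)"
proof -
  have sN: "subgroup N G" using N by (rule normal_imp_subgroup)
  interpret \<Lambda>: group "G Mod N" using N by (rule normal.factorgroup_is_group)
  interpret p: group_hom G "G Mod N" "\<lambda>x. N #> x"
    using normal.r_coset_hom_Mod[OF N] by (unfold_locales) simp
  let ?L = "lower_central (G Mod N) H"
  define M where "M = (\<lambda>i. {x \<in> carrier G. N #> x \<in> ?L i})"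
  have Msub: "subgroup (M i) G" for i
    unfolding M_def by (intro p.subgroup_preimage \<Lambda>.lower_central_subgroup H)
  have Mc: "M i \<subseteq> carrier G" for i by (auto simp: M_def)
  have NM: "N \<subseteq> M i" for i
  proof
    fix x assume x: "x \<in> N"
    then have xc: "x \<in> carrier G" using sN subgroup.subset by blast
    have "N #> x = \<one>\<^bsub>G Mod N\<^esub>" using coset_join2[OF xc sN x] by simp
    also have "\<dots> \<in> ?L i" using \<Lambda>.lower_central_subgroup[OF H(1)] by (rule subgroup.one_closed)
    finally show "x \<in> M i" using xc by (simp add: M_def)
  qed
  have Mdesc: "M (Suc i) \<subseteq> M i" for i
    using \<Lambda>.lower_central_Suc_subset[OF H(1), of i] by (auto simp: M_def simp del: lower_central.simps)
  have Mcomm: "commutator G x y \<in> M (Suc i)" if "x \<in> M 0" "y \<in> M i" for x y i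
    using that \<Lambda>.commutator_in_lower_central[OF H(1)] p.hom_commutator
    by (simp add: M_def del: lower_central.simps(2))
  obtain s where s: "?L s = {\<one>\<^bsub>G Mod N\<^esub>}"
    "\<And>j. j < s \<Longrightarrow> \<exists>A\<subseteq>T. finite A \<and> A \<subseteq> ?L j \<and> generate (G Mod N) A = ?L j"
    using graded_gens_levels[OF \<Lambda>.group_axioms H(1) T(1)] by auto
  obtain A where A: "\<And>j. j < s \<Longrightarrow> A j \<subseteq> T" "\<And>j. j < s \<Longrightarrow> finite (A j)"
    "\<And>j. j < s \<Longrightarrow> A j \<subseteq> ?L j" "\<And>j. j < s \<Longrightarrow> generate (G Mod N) (A j) = ?L j"
    using s(2) by metis
  \<comment> \<open>The lifts are taken inside \<open>S\<^sub>0\<close>, the set for which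
    \<open>act\<close> is available.\<close>
  obtain \<tau> where \<tau>: "\<And>t. t \<in> T \<Longrightarrow> \<tau> t \<in> S\<^sub>0" "\<And>t. t \<in> T \<Longrightarrow> N #> \<tau> t = t"
    using T(2) by (metis (no_types, lifting) image_iff subsetD)
  have \<tau>A: "\<tau> ` A j \<subseteq> M j" if "j < s" for j
  proof
    fix x assume "x \<in> \<tau> ` A j"
    then obtain t where t: "t \<in> A j" "x = \<tau> t" by blast
    then have "t \<in> T" using A(1)[OF that] by blast
    then show "x \<in> M j" using t A(3)[OF that] \<tau>[of t] S\<^sub>0 by (auto simp: M_def)
  qed
  \<comment> \<open>Lifts of generators reach every element up to a factor in the kernel
    \<open>N\<close>, and \<open>N\<close> is contained in \<open>M (Suc j)\<close>.\<close>
  have gen: "M j = generate G (M (Suc j) \<union> \<tau> ` A j)" if j: "j < s" for j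
  proof
    show "generate G (M (Suc j) \<union> \<tau> ` A j) \<subseteq> M j"
      by (rule generate_subgroup_incl[OF _ Msub]) (use Mdesc \<tau>A[OF j] in blast)
    show "M j \<subseteq> generate G (M (Suc j) \<union> \<tau> ` A j)"
    proof
      fix x assume x: "x \<in> M j"
      have "(\<lambda>x. N #> x) ` \<tau> ` A j = A j"
        using \<tau>(2) A(1)[OF j] by (force simp: image_image)
      moreover have c: "\<tau> ` A j \<subseteq> carrier G" using \<tau>A[OF j] Mc by blast
      ultimately have "?L j = (\<lambda>x. N #> x) ` generate G (\<tau> ` A j)"
        using p.generate_img[OF c] A(4)[OF j] by simp
      then obtain y where y: "y \<in> generate G (\<tau> ` A j)" "N #> x = N #> y"
        using x by (auto simp: M_def)
      have "x \<in> N #> y" using rcos_self[OF _ sN, of x] x y(2) by (simp add: M_def)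
      then obtain n where n: "n \<in> N" "x = n \<otimes> y" by (auto simp: r_coset_def)
      have "n \<in> generate G (M (Suc j) \<union> \<tau> ` A j)" using n(1) NM by (auto intro: generate.incl)
      moreover have "y \<in> generate G (M (Suc j) \<union> \<tau> ` A j)"
        using y(1) mono_generate[of "\<tau> ` A j" "M (Suc j) \<union> \<tau> ` A j"] by auto
      ultimately show "x \<in> generate G (M (Suc j) \<union> \<tau> ` A j)" unfolding n(2) by (rule generate.eng)
    qed
  qed
  have Ms: "M s = N"
  proof
    show "M s \<subseteq> N"
    proof
      fix x assume "x \<in> M s"
      then have "x \<in> carrier G" "N #> x = N" using s(1) by (auto simp: M_def)
      then show "x \<in> N" using rcos_self[OF _ sN, of x] by simp
    qed
  qed (rule NM)
  have "poly_growth_on G (M 0)"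
  proof (rule central_series_induct[where s = s and M = M and A = "\<lambda>j. \<tau> ` A j"])
    show "poly_growth_on G (M s)" using growth Ms by simp
    show "finite (\<tau> ` A i)" if "i < s" for i using A(2)[OF that] by simp
  next
    fix K t i assume K: "subgroup K G" "M s \<subseteq> K" "K \<subseteq> M 0" and i: "i < s"
      and t: "t \<in> \<tau> ` A i" "normalises G t K" and IH: "poly_growth_on G K"
    have tS: "t \<in> S\<^sub>0" using t(1) \<tau>(1) A(1)[OF i] by blast
    have tc: "t \<in> carrier G" using tS S\<^sub>0 by blast
    have t0: "t \<in> M 0"
    proof -
      have "?L i \<subseteq> H"
        using \<Lambda>.lower_central_Suc_subset[OF H(1)] by (induction i) (auto simp del: lower_central.simps(2))
      then show ?thesis using t(1) \<tau>A[OF i] by (auto simp: M_def)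
    qed
    have "poly_conjugated G K t x" if x: "x \<in> K" for x
    proof (rule poly_conjugated_iterated_commutator[OF K(1) tc t(2) x, where n = s])
      have "(commutator G t ^^ n) x \<in> M n" for n
        using x K(3) Mcomm[OF t0] by (induction n) auto
      then have "(commutator G t ^^ s) x \<in> N" using Ms by blast
      then show "poly_conjugated G K t ((commutator G t ^^ s) x)"
        using K(1,2) Ms tS t(2) by (intro act) auto
    qed
    then show "poly_growth_on G (generate G (insert t K))"
      by (rule poly_growth_on_generate_insert[OF K(1) tc t(2) IH])
  qed (rule Msub Mdesc Mcomm \<tau>A gen; assumption)+
  moreover obtain C where C: "finite C" "C \<subseteq> carrier G" "\<And>g. g \<in> carrier G \<Longrightarrow> \<exists>m\<in>M 0. \<exists>c\<in>C. g = m \<otimes> c"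
  proof -
    \<comment> \<open>Finitely many group elements already meet all cosets of \<open>H\<close> in
      the quotient; they cover the group by translates of the preimage \<open>M 0\<close>.\<close>
    let ?q = "\<lambda>g. H #>\<^bsub>G Mod N\<^esub> (N #> g)"
    have "?q ` carrier G \<subseteq> rcosets\<^bsub>G Mod N\<^esub> H" by (auto simp: RCOSETS_def carrier_FactGroup)
    then have "finite (?q ` carrier G)"
      using H(2) finite_subset unfolding finite_index_def by blast
    then obtain C where C: "C \<subseteq> carrier G" "finite C" "?q ` carrier G = ?q ` C"
      by (rule exE[OF finite_subset_image[OF _ order_refl]]) (elim conjE)
    have "\<exists>m\<in>M 0. \<exists>c\<in>C. g = m \<otimes> c" if g: "g \<in> carrier G" for g
    proof -
      obtain c where c: "c \<in> C" "?q g = ?q c" using C(3) g by blast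
      have cc: "c \<in> carrier G" using c C by blast
      have "N #> g \<in> ?q c" using \<Lambda>.rcos_self[OF p.hom_closed[OF g] H(1)] c(2) by simp
      then obtain h where h: "h \<in> H" "N #> g = h \<otimes>\<^bsub>G Mod N\<^esub> (N #> c)" by (auto simp: r_coset_def)
      have hc: "h \<in> carrier (G Mod N)" using h(1) subgroup.subset[OF H(1)] by blast
      have "N #> (g \<otimes> inv c) = (N #> g) \<otimes>\<^bsub>G Mod N\<^esub> inv\<^bsub>G Mod N\<^esub> (N #> c)"
        using g cc p.hom_mult p.hom_inv by (simp only: inv_closed)
      also have "\<dots> = h"
        unfolding h(2) using hc p.hom_closed[OF cc] by (simp only: \<Lambda>.m_assoc \<Lambda>.inv_closed \<Lambda>.r_inv \<Lambda>.r_one)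
      finally have "g \<otimes> inv c \<in> M 0" using h(1) g cc by (simp add: M_def)
      moreover have "g = (g \<otimes> inv c) \<otimes> c" using g cc by (simp add: m_assoc)
      ultimately show ?thesis using c(1) by blast
    qed
    then show thesis by (rule that[OF C(2,1)])
  qed
  ultimately show ?thesis using poly_growth_on_finite_cover[OF Msub C] by blast
qed

end

theorem theorem0p7:
  fixes G :: "('a, 'b) monoid_scheme" (structure)
    and N :: "'a set" and Ns :: "nat \<Rightarrow> 'a set" and k :: nat
    and S B S\<^sub>0 :: "'a set"
  assumes "group G" and "finitely_generated G"
    and "N \<lhd> G" and "nilpotent_subgroup G N"
    and "Ns 1 = N" and "Ns (k + 1) = torsion_elements G N"
    and "\<And>h. 1 \<le> h \<Longrightarrow> h \<le> k + 1 \<Longrightarrow> Ns h \<lhd> G"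
    and "\<And>h. 1 \<le> h \<Longrightarrow> h \<le> k \<Longrightarrow> Ns (h + 1) \<subseteq> Ns h"
    and "\<And>h. 1 \<le> h \<Longrightarrow> h \<le> k \<Longrightarrow> commutator_subgroup G N (Ns h) \<subseteq> Ns (h + 1)"
    and "\<And>h. 1 \<le> h \<Longrightarrow> h \<le> k \<Longrightarrow> free_abelian (section_group G (Ns h) (Ns (h + 1)))"
    and "finite S" and "symmetric_generating_set G S"
    and "S = B \<union> S\<^sub>0" and "B \<inter> S\<^sub>0 = {}"
    and "generate G B = N"
    and "generate (G Mod N) ((\<lambda>\<gamma>. N #> \<gamma>) ` S\<^sub>0) = carrier (G Mod N)"
    and "virtually_nilpotent (G Mod N)"
    and "graded_symmetric_generating_set (G Mod N) ((\<lambda>\<gamma>. N #> \<gamma>) ` S\<^sub>0)"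
    and "\<And>\<gamma> h c. \<gamma> \<in> S\<^sub>0 \<Longrightarrow> group.ord (G Mod N) (N #> \<gamma>) = 0 \<Longrightarrow> 1 \<le> h \<Longrightarrow> h \<le> k \<Longrightarrow>
           endo_eigenvalue (section_group G (Ns h) (Ns (h + 1)))
             (conj_action G (Ns h) (Ns (h + 1)) (N #> \<gamma>)) c \<Longrightarrow> cmod c = 1"
  shows "polynomial_growth G"
proof -
  interpret group G by fact
  note N = \<open>N \<lhd> G\<close> and Ns = assms(7) and desc = assms(8) and comm = assms(9)
  have sN: "subgroup N G" using N by (rule normal_imp_subgroup)
  interpret \<Lambda>: group "G Mod N" using N by (rule normal.factorgroup_is_group)
  have S\<^sub>0: "S\<^sub>0 \<subseteq> carrier G" using assms(12,13) by (auto simp: symmetric_generating_set_def)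
  have "finite B" using assms(11,13) by simp
  then have poly: "polycyclic G N" and growth: "poly_growth_on G N"
    using polycyclic_nilpotent poly_growth_on_nilpotent assms(4,15) by blast+
  have NsN: "Ns h \<subseteq> N" if "1 \<le> h" "h \<le> k + 1" for h
    using that
  proof (induction h rule: dec_induct)
    case (step h)
    then show ?case using desc[of h] by auto
  qed (use assms(5) in simp)
  \<comment> \<open>This yields finite generating sets of the \<open>Ns h\<close>, hence finite rank
    of the sections.\<close>
  have polyNs: "polycyclic G (Ns h)" if "1 \<le> h" "h \<le> k + 1" for h
    using polycyclic_subset[OF poly normal_imp_subgroup[OF Ns[OF that]] NsN[OF that]] .
  have "finite (Ns (k + 1))"
    by (rule torsion_polycyclic_finite[OF polyNs]) (use assms(6) in \<open>auto simp: torsion_elements_def\<close>)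
  have act: "\<exists>e>0. \<exists>m. \<forall>x\<in>Ns h. (commutator G (\<gamma> [^] (e::nat)) ^^ m) x \<in> Ns (h + 1)"
    if \<gamma>: "\<gamma> \<in> S\<^sub>0" and h: "1 \<le> h" "h \<le> k" for \<gamma> h
  proof (cases "\<Lambda>.ord (N #> \<gamma>) = 0")
    case True
    obtain F where F: "finite F" "generate G F = Ns h"
      using polycyclic_finitely_generated[OF polyNs[of h]] h by auto
    show ?thesis
      by (rule iterated_commutator_in_section[OF assms(1) N _ _ desc[OF h] comm[OF h] F assms(10)[OF h]])
        (use Ns[of h] Ns[of "h + 1"] h \<gamma> S\<^sub>0 assms(19)[OF \<gamma> True h] in auto)
  next
    case False
    \<comment> \<open>\<open>ord\<close> is nonzero, so the image has finite order and
      \<open>\<gamma>^e\<close> lies in \<open>N\<close>. A single commutation then already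
      descends, with \<open>m = 1\<close>.\<close>
    let ?e = "\<Lambda>.ord (N #> \<gamma>)"
    have \<gamma>c: "\<gamma> \<in> carrier G" using \<gamma> S\<^sub>0 by blast
    interpret p: group_hom G "G Mod N" "\<lambda>x. N #> x"
      using normal.r_coset_hom_Mod[OF N] by (unfold_locales) simp
    have "N #> (\<gamma> [^] ?e) = \<one>\<^bsub>G Mod N\<^esub>"
      using p.hom_nat_pow[OF \<gamma>c] \<Lambda>.pow_ord_eq_1[OF p.hom_closed[OF \<gamma>c]] by simp
    then have "\<gamma> [^] ?e \<in> N" using rcos_self[OF nat_pow_closed[OF \<gamma>c] sN, of ?e] by simp
    then have "commutator G (\<gamma> [^] ?e) x \<in> Ns (h + 1)" if "x \<in> Ns h" for x
      using commutator_in_commutator_subgroup[OF _ that] comm[OF h] by blast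
    then show ?thesis using False by (intro exI[of _ ?e] conjI exI[of _ 1]) auto
  qed
  obtain H T C where H: "nilpotent_subgroup (G Mod N) H" "finite_index (G Mod N) H"
    and T: "graded_gens (G Mod N) H 0 T"
    and U: "(\<lambda>\<gamma>. N #> \<gamma>) ` S\<^sub>0 = (T \<union> C) \<union> (\<lambda>x. inv\<^bsub>G Mod N\<^esub> x) ` (T \<union> C)"
    using assms(18) unfolding graded_symmetric_generating_set_def graded_generating_set_def
    by (elim exE conjE) (rule that; assumption)
  have TS: "T \<subseteq> (\<lambda>\<gamma>. N #> \<gamma>) ` S\<^sub>0" unfolding U by blast
  have "poly_growth_on G (carrier G)"
  proof (rule poly_growth_on_virtually_nilpotent_extension[OF N growth _ H(2) T TS S\<^sub>0])
    show "subgroup H (G Mod N)" using H(1) by (simp add: nilpotent_subgroup_def)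
    fix K t x assume K: "subgroup K G" "N \<subseteq> K" and t: "t \<in> S\<^sub>0" "normalises G t K" and x: "x \<in> N"
    have tc: "t \<in> carrier G" using t S\<^sub>0 by blast
    show "poly_conjugated G K t x"
    proof (rule poly_conjugated_filtration[OF K(1) tc t(2), where Ns = Ns and k = k])
      show "Ns h \<subseteq> K" if "1 \<le> h" "h \<le> k + 1" for h using NsN[OF that] K(2) by blast
      show "x \<in> Ns 1" using x assms(5) by simp
      \<comment> \<open>The torsion subgroup is finite and normal, so conjugation by
        \<open>t\<close> moves \<open>y\<close> only within a finite set.\<close>
      show "poly_conjugated G K t y" if "y \<in> Ns (k + 1)" for y
        using \<open>finite (Ns (k + 1))\<close> NsN[of "k + 1"] K Ns[of "k + 1"] tc that subgroup.subset[OF K(1)]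
        by (intro poly_conjugated_finite[of "Ns (k + 1)"] normalises_normal) auto
    qed (rule act[OF t(1)])
  qed
  then show ?thesis by (rule polynomial_growth_if_poly_growth_on[OF assms(11,12)])
qed

end
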